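(* Let $n\ge 1$, let $\Omega$ be a finite set, and let $X,Y\in Z_n(\Omega;\mathbf{Q})$ be rational $n$-cycles such that $|\mathrm{Vert}(X)\cap\mathrm{Vert}(Y)|\le n+1$. Then $$\mathrm{Qvol}(X+Y)=\mathrm{Qvol}(X)+\mathrm{Qvol}(Y).$$ Moreover, if $n\ge 2$, then every taut $\mathbf{Q}$-filling $M$ of $X+Y$ can be written as $M=M_X+M_Y$ with $M_X$ a taut $\mathbf{Q}$-filling of $X$ and $M_Y$ a taut $\mathbf{Q}$-filling of $Y$.
   Context: For a finite set $\Omega$, $\Delta(\Omega)$ is the abstract simplicial complex of all subsets of $\Omega$, $C_k(\Omega;\mathbf{Q})$ denotes its oriented simplicial $k$-chains with rational coefficients, and $Z_k(\Omega;\mathbf{Q})$ the $k$-cycles. $\mathrm{Vert}(X)$ is the set of all vertices of all simplices to which the chain $X$ assigns nonzero coefficient. The $L_1$-norm $|M|$ of a chain is the sum of the absolute values of its coefficients over unoriented simplices. A $\mathbf{Q}$-filling of an $n$-cycle $X$ is a chain $M\in C_{n+1}(\Omega;\mathbf{Q})$ with $\partial M=X$; $\mathrm{Qvol}(X)$ is the minimum of $|M|$ over all $\mathbf{Q}$-fillings $M$ of $X$ (the minimum is attained, this being a linear program); a taut $\mathbf{Q}$-filling of $X$ is a $\mathbf{Q}$-filling $M$ of $X$ with $|M|=\mathrm{Qvol}(X)$. *)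

theory Defs
  imports Complex_Main "HOL-Library.Function_Algebras" "HOL-Combinatorics.Permutations"
begin

text \<open>
  An oriented \<open>k\<close>-chain is encoded by its coefficient function: \<open>c [v\<^sub>0, \<dots>, v\<^sub>k]\<close> is the coefficient
  of the oriented simplex \<open>[v\<^sub>0, \<dots>, v\<^sub>k]\<close>. The relation identifying an odd reordering of a simplex
  with its negative becomes the requirement that the function is alternating. Addition of chains is
  pointwise addition of functions. Every nonempty subset of the vertex set is a simplex.
\<close>

definition alternating :: "('a list \<Rightarrow> rat) \<Rightarrow> bool" where
  "alternating c \<longleftrightarrow>
     (\<forall>vs p. p permutes {..<length vs} \<longrightarrow> c (permute_list p vs) = of_int (sign p) * c vs)"

definition oriented_chains :: "'a set \<Rightarrow> nat \<Rightarrow> ('a list \<Rightarrow> rat) set" where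
  "oriented_chains \<Omega> k =
     {c. alternating c \<and>
         (\<forall>vs. c vs \<noteq> 0 \<longrightarrow> length vs = k + 1 \<and> distinct vs \<and> set vs \<subseteq> \<Omega>)}"

text \<open>
  The coefficient of \<open>[w\<^sub>1, \<dots>, w\<^sub>k]\<close> in the boundary collects one term \<open>c [x, w\<^sub>1, \<dots>, w\<^sub>k]\<close> for every
  vertex \<open>x\<close>: each coface can be oriented so that the added vertex comes first. The lemmas
  \<open>boundary_oriented_simplex\<close> and \<open>chain_expansion\<close> below show that this is the linear extension of
  \<open>[v\<^sub>0, \<dots>, v\<^sub>k] \<mapsto> \<Sum>\<^sub>i (-1)\<^sup>i [v\<^sub>0, \<dots>, v\<^sub>i\<^sub>-\<^sub>1, v\<^sub>i\<^sub>+\<^sub>1, \<dots>, v\<^sub>k]\<close>. On \<open>0\<close>-chains it is the augmentation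
  (with value at the empty list), which plays no role for cycles of dimension at least \<open>1\<close>.
\<close>

definition boundary :: "'a set \<Rightarrow> ('a list \<Rightarrow> rat) \<Rightarrow> ('a list \<Rightarrow> rat)" where
  "boundary \<Omega> c = (\<lambda>ws. \<Sum>x\<in>\<Omega>. c (x # ws))"

definition cycles :: "'a set \<Rightarrow> nat \<Rightarrow> ('a list \<Rightarrow> rat) set" where
  "cycles \<Omega> k = {c \<in> oriented_chains \<Omega> k. boundary \<Omega> c = 0}"

definition Vert :: "('a list \<Rightarrow> rat) \<Rightarrow> 'a set" where
  "Vert c = \<Union> (set ` {vs. c vs \<noteq> 0})"

text \<open>
  The sum runs over the unoriented simplices of nonzero coefficient, that is, over vertex sets. The
  orientation chosen for a simplex affects only the sign of its coefficient.
\<close>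

definition l1_norm :: "('a list \<Rightarrow> rat) \<Rightarrow> rat" where
  "l1_norm c =
     (\<Sum>\<sigma> \<in> set ` {vs. c vs \<noteq> 0}. \<bar>c (SOME vs. distinct vs \<and> set vs = \<sigma>)\<bar>)"

definition fillings :: "'a set \<Rightarrow> nat \<Rightarrow> ('a list \<Rightarrow> rat) \<Rightarrow> ('a list \<Rightarrow> rat) set" where
  "fillings \<Omega> n X = {M \<in> oriented_chains \<Omega> (n + 1). boundary \<Omega> M = X}"

text \<open>
  For finite \<open>\<Omega>\<close> and a cycle of dimension at least \<open>1\<close>, fillings exist and the minimum is attained
  (a linear program with rational data), so the least element below is the minimum norm.
\<close>

definition Qvol :: "'a set \<Rightarrow> nat \<Rightarrow> ('a list \<Rightarrow> rat) \<Rightarrow> rat" where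
  "Qvol \<Omega> n X = (LEAST q. \<exists>M \<in> fillings \<Omega> n X. q = l1_norm M)"

definition taut_filling :: "'a set \<Rightarrow> nat \<Rightarrow> ('a list \<Rightarrow> rat) \<Rightarrow> ('a list \<Rightarrow> rat) \<Rightarrow> bool" where
  "taut_filling \<Omega> n X M \<longleftrightarrow> M \<in> fillings \<Omega> n X \<and> l1_norm M = Qvol \<Omega> n X"

definition oriented_simplex :: "'a list \<Rightarrow> ('a list \<Rightarrow> rat)" where
  "oriented_simplex vs =
     (\<lambda>ws. \<Sum>p | p permutes {..<length vs} \<and> permute_list p vs = ws. of_int (sign p))"

lemma alternatingD:
  "alternating c \<Longrightarrow> p permutes {..<length vs} \<Longrightarrow>
     c (permute_list p vs) = of_int (sign p) * c vs"
  unfolding alternating_def by blast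

lemma distinct_reorder:
  assumes "distinct vs" "distinct ws" "set vs = set ws"
  obtains p where "p permutes {..<length vs}" "permute_list p vs = ws"
  using assms set_eq_iff_mset_eq_distinct mset_eq_permutation by metis

lemma alternating_abs_cong:
  assumes "alternating c" "distinct vs" "distinct ws" "set vs = set ws"
  shows "\<bar>c vs\<bar> = \<bar>c ws\<bar>"
proof -
  obtain p where "p permutes {..<length vs}" "permute_list p vs = ws"
    using distinct_reorder[OF assms(2-4)] .
  then show ?thesis
    using alternatingD[OF assms(1), of p vs] by (cases p rule: sign_cases) auto
qed

lemma alternating_eqI:
  assumes "alternating c" "alternating d" "distinct vs" "distinct ws" "set vs = set ws"
    and "c vs = d vs"
  shows "c ws = d ws"
proof -
  obtain p where "p permutes {..<length vs}" "permute_list p vs = ws"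
    using distinct_reorder[OF assms(3-5)] .
  then show ?thesis
    using alternatingD[OF assms(1), of p vs] alternatingD[OF assms(2), of p vs] assms(6) by simp
qed

lemma oriented_simplex_permute:
  assumes "distinct vs" "p permutes {..<length vs}"
  shows "oriented_simplex vs (permute_list p vs) = of_int (sign p)"
proof -
  have "q = p" if "q permutes {..<length vs}" "permute_list q vs = permute_list p vs" for q
  proof
    fix i
    show "q i = p i"
    proof (cases "i < length vs")
      case True
      then have "vs ! q i = vs ! p i"
        using that assms(2) permute_list_nth by metis
      moreover have "q i < length vs" "p i < length vs"
        using True permutes_in_image[OF that(1), of i] permutes_in_image[OF assms(2), of i]
        by auto
      ultimately show ?thesis
        using assms(1) nth_eq_iff_index_eq by blast
    next
      case False
      then show ?thesis
        using that(1) assms(2) by (simp add: permutes_not_in)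
    qed
  qed
  then have "{q. q permutes {..<length vs} \<and> permute_list q vs = permute_list p vs} = {p}"
    using assms(2) by blast
  then show ?thesis by (simp add: oriented_simplex_def)
qed

lemma oriented_simplex_self: "distinct vs \<Longrightarrow> oriented_simplex vs vs = 1"
  using oriented_simplex_permute[of vs id] by (simp add: permutes_id)

lemma oriented_simplex_eq_0:
  assumes "mset ws \<noteq> mset vs"
  shows "oriented_simplex vs ws = 0"
proof -
  have "{p. p permutes {..<length vs} \<and> permute_list p vs = ws} = {}"
    using assms mset_permute_list by blast
  then show ?thesis unfolding oriented_simplex_def by (simp only: sum.empty)
qed

lemma alternating_oriented_simplex:
  assumes "distinct vs"
  shows "alternating (oriented_simplex vs)"
  unfolding alternating_def
proof (intro allI impI)
  fix ws :: "'a list" and q assume q: "q permutes {..<length ws}"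
  show "oriented_simplex vs (permute_list q ws) = of_int (sign q) * oriented_simplex vs ws"
  proof (cases "mset ws = mset vs")
    case True
    then obtain p where p: "p permutes {..<length vs}" "permute_list p vs = ws"
      using mset_eq_permutation by metis
    have len: "length ws = length vs" using True by (metis size_mset)
    have perm: "permutation p" "permutation q"
      using p(1) q permutation_permutes by blast+
    have "permute_list q ws = permute_list (p \<circ> q) vs"
      using p q len by (simp add: permute_list_compose)
    then show ?thesis
      using oriented_simplex_permute[OF assms, of "p \<circ> q"] oriented_simplex_permute[OF assms p(1)]
        p q len perm by (simp add: permutes_compose sign_compose)
  next
    case False
    then show ?thesis using q by (simp add: oriented_simplex_eq_0)
  qed
qed

lemma oriented_simplex_in_chains:
  assumes "distinct vs" "length vs = k + 1" "set vs \<subseteq> \<Omega>"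
  shows "oriented_simplex vs \<in> oriented_chains \<Omega> k"
  unfolding oriented_chains_def
proof (intro CollectI conjI allI impI)
  show "alternating (oriented_simplex vs)" using assms(1) by (rule alternating_oriented_simplex)
next
  fix ws assume "oriented_simplex vs ws \<noteq> 0"
  then have eq: "mset ws = mset vs" using oriented_simplex_eq_0 by blast
  then show "length ws = k + 1" "distinct ws" "set ws \<subseteq> \<Omega>"
    using assms mset_eq_length[OF eq] mset_eq_imp_distinct_iff[OF eq] mset_eq_setD[OF eq] by auto
qed

lemma alternating_Cons:
  assumes "alternating c"
  shows "alternating (\<lambda>ws. c (x # ws))"
  unfolding alternating_def
proof (intro allI impI)
  fix ws :: "'a list" and p assume "p permutes {..<length ws}"
  with finite_lessThan show "c (x # permute_list p ws) = of_int (sign p) * c (x # ws)"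
  proof (induction rule: permutes_rev_induct)
    case id
    then show ?case by simp
  next
    case (swap a b p)
    let ?t = "transpose a b" and ?t' = "transpose (Suc a) (Suc b)"
    let ?us = "permute_list p ws"
    have t: "?t permutes {..<length ws}"
      using swap by (intro permutes_swap_id)
    have "?t' permutes {..<length (x # ?us)}"
      using swap by (intro permutes_swap_id) auto
    moreover have "permute_list ?t' (x # ?us) = x # permute_list ?t ?us"
      by (simp add: permute_list_def map_upt_Suc Transposition.transpose_def if_distrib del: upt_Suc)
    ultimately have "c (x # permute_list ?t ?us) = - c (x # ?us)"
      using alternatingD[OF assms, of ?t' "x # ?us"] swap.hyps by (simp add: sign_swap_id)
    moreover have "permute_list (p \<circ> ?t) ws = permute_list ?t ?us"
      using t by (rule permute_list_compose)
    moreover have "sign (p \<circ> ?t) = - sign p"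
    proof -
      have "permutation p" using swap.hyps permutation_permutes finite_lessThan by blast
      then show ?thesis
        using swap.hyps by (simp add: sign_compose permutation_swap_id sign_swap_id)
    qed
    ultimately show ?case using swap.IH by (simp only: of_int_minus mult_minus_left)
  qed
qed

lemma alternating_move_to_front:
  assumes "alternating c"
  shows "c (us @ x # ws) = (- 1) ^ length us * c (x # us @ ws)"
  using assms
proof (induction us arbitrary: c)
  case Nil
  then show ?case by simp
next
  case (Cons a us)
  let ?t = "transpose 0 (Suc 0)"
  have "?t permutes {..<length (x # a # us @ ws)}"
    by (intro permutes_swap_id) auto
  moreover have "permute_list ?t (x # a # us @ ws) = a # x # us @ ws"
    using map_nth[of "us @ ws"]
    by (simp add: permute_list_def map_upt_Suc Transposition.transpose_def del: upt_Suc)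
  ultimately have "c (a # x # us @ ws) = - c (x # a # us @ ws)"
    using alternatingD[OF Cons.prems, of ?t "x # a # us @ ws"] by (simp add: sign_swap_id)
  then show ?case
    using Cons.IH[OF alternating_Cons[OF Cons.prems, of a]] by simp
qed

lemma alternating_sum:
  fixes f :: "'i \<Rightarrow> 'a list \<Rightarrow> rat"
  assumes "\<And>i. i \<in> I \<Longrightarrow> alternating (f i)"
  shows "alternating (\<lambda>ws. \<Sum>i\<in>I. a i * f i ws)"
  unfolding alternating_def
proof (intro allI impI)
  fix ws :: "'a list" and p assume "p permutes {..<length ws}"
  then have "a i * f i (permute_list p ws) = of_int (sign p) * (a i * f i ws)" if "i \<in> I" for i
    using alternatingD[OF assms[OF that]] by simp
  then show "(\<Sum>i\<in>I. a i * f i (permute_list p ws)) = of_int (sign p) * (\<Sum>i\<in>I. a i * f i ws)"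
    unfolding sum_distrib_left by (rule sum.cong[OF refl])
qed

lemma alternating_boundary: "alternating c \<Longrightarrow> alternating (boundary \<Omega> c)"
  using alternating_sum[of \<Omega> "\<lambda>x ws. c (x # ws)" "\<lambda>_. 1"]
  by (simp add: boundary_def alternating_Cons)

lemma boundary_oriented_simplex:
  assumes "finite \<Omega>" "distinct vs" "set vs \<subseteq> \<Omega>"
  shows "boundary \<Omega> (oriented_simplex vs) =
    (\<lambda>ws. \<Sum>i<length vs. (- 1) ^ i * oriented_simplex (take i vs @ drop (Suc i) vs) ws)"
    (is "?L = ?R")
proof
  fix ws
  let ?face = "\<lambda>i. take i vs @ drop (Suc i) vs"
  have split: "vs = take i vs @ vs ! i # drop (Suc i) vs" if "i < length vs" for i
    using that by (rule id_take_nth_drop)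
  have mset_face: "mset vs = add_mset (vs ! i) (mset (?face i))" if "i < length vs" for i
    using arg_cong[OF split[OF that], of mset] by simp
  have dist_face: "distinct (?face i)" "vs ! i \<notin> set (?face i)" if "i < length vs" for i
  proof -
    have "distinct (take i vs @ vs ! i # drop (Suc i) vs)"
      using split[OF that] assms(2) by (rule subst)
    then show "distinct (?face i)" "vs ! i \<notin> set (?face i)" by simp_all
  qed
  show "?L ws = ?R ws"
  proof (cases "\<exists>i<length vs. mset ws = mset (?face i)")
    case True
    then obtain i where i: "i < length vs" "mset ws = mset (?face i)" by blast
    have ws: "distinct ws" "set (?face i) = set ws"
      using dist_face(1)[OF i(1)] mset_eq_imp_distinct_iff[OF i(2)] mset_eq_setD[OF i(2)] by auto
    have "oriented_simplex vs (x # ?face i) = 0" if "x \<noteq> vs ! i" for x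
      using that mset_face[OF i(1)] by (intro oriented_simplex_eq_0) simp
    then have "?L (?face i) = oriented_simplex vs (vs ! i # ?face i)"
      unfolding boundary_def using assms i(1) nth_mem[OF i(1)]
      by (subst sum.mono_neutral_right[of \<Omega> "{vs ! i}"]) auto
    also have "\<dots> = (- 1) ^ i"
    proof -
      have "oriented_simplex vs vs = (- 1) ^ i * oriented_simplex vs (vs ! i # ?face i)"
        using alternating_move_to_front[OF alternating_oriented_simplex[OF assms(2)],
            of "take i vs" "vs ! i" "drop (Suc i) vs"] i(1)
        by (simp add: split[OF i(1), symmetric] del: append_take_drop_id)
      then have "(- 1) ^ i * oriented_simplex vs (vs ! i # ?face i) = 1"
        using oriented_simplex_self[OF assms(2)] by (rule trans[OF sym])
      moreover have "(- 1) ^ i * ((- 1) ^ i * oriented_simplex vs (vs ! i # ?face i))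
          = oriented_simplex vs (vs ! i # ?face i)"
        by (rule left_minus_one_mult_self)
      ultimately show ?thesis by (metis mult.right_neutral)
    qed
    also have "\<dots> = ?R (?face i)"
    proof -
      have "oriented_simplex (?face j) (?face i) = 0" if "j < length vs" "j \<noteq> i" for j
      proof (rule oriented_simplex_eq_0, rule notI)
        assume "mset (?face i) = mset (?face j)"
        then have "vs ! i = vs ! j"
          using mset_face[OF i(1)] mset_face[OF that(1)] by simp
        then show False
          using that i(1) assms(2) nth_eq_iff_index_eq by blast
      qed
      then show ?thesis
        using i(1) oriented_simplex_self[OF dist_face(1)[OF i(1)]]
        by (subst sum.mono_neutral_right[of "{..<length vs}" "{i}"]) auto
    qed
    finally have "?L (?face i) = ?R (?face i)" .
    moreover have "alternating ?L"
      using assms(2) by (intro alternating_boundary alternating_oriented_simplex)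
    moreover have "alternating ?R"
      using dist_face(1) by (intro alternating_sum alternating_oriented_simplex) simp
    ultimately show ?thesis
      using alternating_eqI dist_face(1)[OF i(1)] ws by blast
  next
    case False
    have "oriented_simplex vs (x # ws) = 0" for x
    proof (rule oriented_simplex_eq_0, rule notI)
      assume eq: "mset (x # ws) = mset vs"
      then have "x \<in> set vs" by (metis list.set_intros(1) mset_eq_setD)
      then obtain i where i: "i < length vs" "x = vs ! i" by (metis in_set_conv_nth)
      then have "mset ws = mset (?face i)"
        using eq mset_face[OF i(1)] by simp
      with i(1) False show False by blast
    qed
    moreover have "oriented_simplex (?face i) ws = 0" if "i < length vs" for i
      using that False by (intro oriented_simplex_eq_0) blast
    ultimately show ?thesis by (simp add: boundary_def)
  qed
qed

lemma chain_expansion: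
  assumes "finite \<Omega>" "c \<in> oriented_chains \<Omega> k"
    and l: "\<And>\<sigma>. \<sigma> \<subseteq> \<Omega> \<Longrightarrow> distinct (l \<sigma>) \<and> set (l \<sigma>) = \<sigma>"
  shows "c = (\<lambda>ws. \<Sum>\<sigma> | \<sigma> \<subseteq> \<Omega> \<and> card \<sigma> = k + 1. c (l \<sigma>) * oriented_simplex (l \<sigma>) ws)"
    (is "c = ?R")
proof
  fix ws
  let ?S = "{\<sigma>. \<sigma> \<subseteq> \<Omega> \<and> card \<sigma> = k + 1}"
  have fin: "finite ?S" using assms(1) by simp
  have alt: "alternating c" and supp: "c vs \<noteq> 0 \<Longrightarrow> length vs = k + 1 \<and> distinct vs \<and> set vs \<subseteq> \<Omega>" for vs
    using assms(2) by (auto simp: oriented_chains_def)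
  have zero: "oriented_simplex (l \<sigma>) ws = 0"
    if "\<sigma> \<in> ?S" "\<not> (distinct ws \<and> set ws = \<sigma>)" for \<sigma>
  proof (rule oriented_simplex_eq_0, rule notI)
    assume eq: "mset ws = mset (l \<sigma>)"
    show False
      using that l[of \<sigma>] mset_eq_imp_distinct_iff[OF eq] mset_eq_setD[OF eq] by auto
  qed
  show "c ws = ?R ws"
  proof (cases "distinct ws \<and> set ws \<in> ?S")
    case True
    let ?vs = "l (set ws)"
    have vs: "distinct ?vs" "set ?vs = set ws" using l True by auto
    have "?R ws = c ?vs * oriented_simplex ?vs ws"
      using True fin zero by (subst sum.mono_neutral_right[of ?S "{set ws}"]) auto
    moreover obtain p where "p permutes {..<length ?vs}" "permute_list p ?vs = ws"
      using distinct_reorder[OF vs(1) _ vs(2)] True by blast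
    ultimately show ?thesis
      using alternatingD[OF alt] oriented_simplex_permute[OF vs(1)] by (metis mult.commute)
  next
    case False
    then have "c ws = 0" using supp[of ws] distinct_card[of ws] by auto
    moreover have "?R ws = 0" using False zero by (intro sum.neutral) auto
    ultimately show ?thesis by simp
  qed
qed

end

theory Submission
  imports Defs "HOL-Combinatorics.Multiset_Permutations"
begin

text \<open>
  Let \<open>A\<close> and \<open>B\<close> be the vertex sets of \<open>X\<close> and \<open>Y\<close>. Collapsing everything outside \<open>A\<close> to a vertex
  \<open>c \<in> A \<inter> B\<close> fixes \<open>X\<close> and kills \<open>Y\<close>, since a nonzero \<open>n\<close>-cycle needs \<open>n + 2\<close> vertices; so it maps
  a filling \<open>M\<close> of \<open>X + Y\<close> to a filling of \<open>X\<close>. Likewise collapsing the complement of \<open>B\<close> to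
  \<open>d \<in> A \<inter> B\<close> yields a filling of \<open>Y\<close>. With \<open>c \<noteq> d\<close> if \<open>A \<inter> B\<close> has \<open>n + 1\<close> elements, no
  \<open>(n + 1)\<close>-simplex is nondegenerate under both collapses, whence \<open>Qvol X + Qvol Y \<le> |M|\<close>. If \<open>M\<close> is
  taut, each of its simplices is nondegenerate under one of the two collapses for all choices of \<open>c\<close>
  and \<open>d\<close>. For \<open>n \<ge> 2\<close> this separates the simplices of \<open>M\<close> into two classes that share no
  \<open>n\<close>-face outside \<open>A \<inter> B\<close>.
\<close>

section \<open>Chains as functions on tuples\<close>

text \<open>Index set for sums over ordered simplices, degenerate tuples included; norms and
  pushforwards become plain finite sums without a choice of orientations.\<close>

definition tuples :: "'a set \<Rightarrow> nat \<Rightarrow> 'a list set" where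
  "tuples \<Omega> k = {vs. set vs \<subseteq> \<Omega> \<and> length vs = k}"

lemma finite_tuples [simp]: "finite \<Omega> \<Longrightarrow> finite (tuples \<Omega> k)"
  unfolding tuples_def by (rule finite_lists_length_eq)

text \<open>Exchanging two equal entries fixes the tuple but negates its coefficient.\<close>

lemma alternating_eq_0:
  assumes "alternating c" "\<not> distinct vs"
  shows "c vs = 0"
proof -
  obtain i j where ij: "i < length vs" "j < length vs" "i \<noteq> j" "vs ! i = vs ! j"
    using assms(2) by (auto simp: distinct_conv_nth)
  let ?t = "transpose i j"
  have t: "?t permutes {..<length vs}"
    using ij by (intro permutes_swap_id) auto
  have "permute_list ?t vs = vs"
  proof (rule nth_equalityI)
    fix m assume "m < length (permute_list ?t vs)"
    then show "permute_list ?t vs ! m = vs ! m"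
      using t ij by (simp add: permute_list_nth Transposition.transpose_def)
  qed simp
  then have "c vs = - c vs"
    using alternatingD[OF assms(1) t] ij(3) by (simp add: sign_swap_id)
  then show ?thesis by simp
qed

text \<open>Distinctness of the entries on the support comes for free from alternation.\<close>

lemma oriented_chainsI:
  assumes "alternating c" "\<And>vs. c vs \<noteq> 0 \<Longrightarrow> vs \<in> tuples \<Omega> (k + 1)"
  shows "c \<in> oriented_chains \<Omega> k"
  using assms alternating_eq_0[OF assms(1)] unfolding oriented_chains_def tuples_def by blast

lemma oriented_chainsD:
  assumes "c \<in> oriented_chains \<Omega> k"
  shows "alternating c" "c vs \<noteq> 0 \<Longrightarrow> vs \<in> tuples \<Omega> (k + 1)" "c vs \<noteq> 0 \<Longrightarrow> distinct vs"
  using assms by (auto simp: oriented_chains_def tuples_def)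

lemma alternating_combine:
  assumes "alternating c" "alternating d"
  shows "alternating (\<lambda>vs. r * c vs + s * d vs)"
  using assms unfolding alternating_def by (simp add: algebra_simps)

lemma chains_combine:
  assumes "c \<in> oriented_chains \<Omega> k" "d \<in> oriented_chains \<Omega> k"
  shows "(\<lambda>vs. r * c vs + s * d vs) \<in> oriented_chains \<Omega> k"
proof (rule oriented_chainsI)
  show "alternating (\<lambda>vs. r * c vs + s * d vs)"
    using assms by (intro alternating_combine oriented_chainsD(1))
  fix vs assume "r * c vs + s * d vs \<noteq> 0"
  then have "c vs \<noteq> 0 \<or> d vs \<noteq> 0" by auto
  then show "vs \<in> tuples \<Omega> (k + 1)"
    using oriented_chainsD(2)[OF assms(1)] oriented_chainsD(2)[OF assms(2)] by blast
qed

lemma chains_add: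
  assumes "c \<in> oriented_chains \<Omega> k" "d \<in> oriented_chains \<Omega> k"
  shows "c + d \<in> oriented_chains \<Omega> k"
  using chains_combine[OF assms, of 1 1] by (simp add: plus_fun_def)

lemma chains_diff:
  assumes "c \<in> oriented_chains \<Omega> k" "d \<in> oriented_chains \<Omega> k"
  shows "c - d \<in> oriented_chains \<Omega> k"
  using chains_combine[OF assms, of 1 "-1"] by (simp add: fun_diff_def)

lemma boundary_add: "boundary \<Omega> (c + d) = boundary \<Omega> c + boundary \<Omega> d"
  by (auto simp: boundary_def sum.distrib)

lemma boundary_diff: "boundary \<Omega> (c - d) = boundary \<Omega> c - boundary \<Omega> d"
  by (auto simp: boundary_def sum_subtractf)

text \<open>Interchanging the two added vertices negates \<open>c\<close>, while interchanging the
  two sums changes nothing; so the double sum equals its own negative.\<close>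

lemma boundary_boundary:
  assumes "alternating c"
  shows "boundary \<Omega> (boundary \<Omega> c) = 0"
proof
  fix ws
  have swap: "c (y # x # ws) = - c (x # y # ws)" for x y
    using alternating_move_to_front[OF assms, of "[y]" x ws] by simp
  have "boundary \<Omega> (boundary \<Omega> c) ws = (\<Sum>x\<in>\<Omega>. \<Sum>y\<in>\<Omega>. c (y # x # ws))"
    by (simp add: boundary_def)
  also have "\<dots> = (\<Sum>y\<in>\<Omega>. \<Sum>x\<in>\<Omega>. c (y # x # ws))"
    by (rule sum.swap)
  also have "\<dots> = - boundary \<Omega> (boundary \<Omega> c) ws"
    by (subst swap) (simp add: boundary_def sum_negf)
  finally show "boundary \<Omega> (boundary \<Omega> c) ws = 0 ws" by simp
qed

lemma set_subset_Vert: "c vs \<noteq> 0 \<Longrightarrow> set vs \<subseteq> Vert c"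
  by (auto simp: Vert_def)

lemma Vert_subset: "c \<in> oriented_chains \<Omega> k \<Longrightarrow> Vert c \<subseteq> \<Omega>"
  by (auto simp: Vert_def oriented_chains_def)

text \<open>A cycle carried by a single simplex vanishes, because the boundary of that simplex does not.\<close>

lemma cycle_on_few_vertices:
  assumes "finite \<Omega>" "Z \<in> oriented_chains \<Omega> n" "boundary \<Omega> Z = 0"
    and D: "Vert Z \<subseteq> D" "finite D" "card D \<le> n + 1"
  shows "Z = 0"
proof (rule ccontr)
  assume "Z \<noteq> 0"
  then obtain ws where ws: "Z ws \<noteq> 0" by (auto simp: fun_eq_iff)
  then obtain x us where xus: "ws = x # us"
    using oriented_chainsD(2)[OF assms(2) ws] by (cases ws) (auto simp: tuples_def)
  have facts: "distinct vs \<and> length vs = n + 1 \<and> set vs = D" if "Z vs \<noteq> 0" for vs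
  proof -
    have "distinct vs" "length vs = n + 1" "set vs \<subseteq> D"
      using oriented_chainsD[OF assms(2)] that set_subset_Vert[of Z vs] D(1)
      by (auto simp: tuples_def)
    then show ?thesis using D card_seteq[of D "set vs"] distinct_card[of vs] by auto
  qed
  \<comment> \<open>Every simplex of \<open>Z\<close> has vertex set exactly \<open>D\<close>, so
    \<open>us\<close> leaves only one possible extra vertex and the boundary at \<open>us\<close> is
    a single term.\<close>
  have "y = x" if "Z (y # us) \<noteq> 0" for y
    using facts[OF that] facts[OF ws] unfolding xus by auto
  moreover have "x \<in> \<Omega>"
    using oriented_chainsD(2)[OF assms(2) ws] xus by (auto simp: tuples_def)
  ultimately have "boundary \<Omega> Z us = Z ws"
    unfolding boundary_def using assms(1) xus
    by (subst sum.mono_neutral_right[of \<Omega> "{x}"]) auto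
  then show False using ws assms(3) by simp
qed

text \<open>A simplex on \<open>k\<close> vertices corresponds to \<open>fact k\<close> tuples.\<close>

lemma l1_norm_eq_sum_tuples:
  assumes "finite \<Omega>" "c \<in> oriented_chains \<Omega> k"
  shows "fact (k + 1) * l1_norm c = (\<Sum>vs\<in>tuples \<Omega> (k + 1). \<bar>c vs\<bar>)"
proof -
  let ?S = "{vs. c vs \<noteq> 0}"
  have sub: "?S \<subseteq> tuples \<Omega> (k + 1)" and dist: "\<And>vs. vs \<in> ?S \<Longrightarrow> distinct vs"
    using oriented_chainsD[OF assms(2)] by auto
  have fin: "finite ?S" using sub assms(1) by (meson finite_subset finite_tuples)
  have "(\<Sum>vs\<in>tuples \<Omega> (k + 1). \<bar>c vs\<bar>) = (\<Sum>vs\<in>?S. \<bar>c vs\<bar>)"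
    using assms(1) sub by (intro sum.mono_neutral_right) auto
  also have "\<dots> = (\<Sum>\<sigma>\<in>set ` ?S. \<Sum>vs | vs \<in> ?S \<and> set vs = \<sigma>. \<bar>c vs\<bar>)"
    by (rule sum.image_gen[OF fin])
  also have "\<dots> = (\<Sum>\<sigma>\<in>set ` ?S. fact (k + 1) * \<bar>c (SOME vs. distinct vs \<and> set vs = \<sigma>)\<bar>)"
  proof (rule sum.cong[OF refl])
    fix \<sigma> assume "\<sigma> \<in> set ` ?S"
    then obtain vs where vs: "c vs \<noteq> 0" "\<sigma> = set vs" by auto
    have card: "card \<sigma> = k + 1" "finite \<sigma>"
      using vs sub dist[of vs] distinct_card[of vs] by (auto simp: tuples_def)
    let ?l = "SOME vs. distinct vs \<and> set vs = \<sigma>"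
    have l: "distinct ?l \<and> set ?l = \<sigma>"
      by (rule someI[of _ vs]) (use vs dist in auto)
    have eq: "\<bar>c ws\<bar> = \<bar>c ?l\<bar>" if "distinct ws" "set ws = \<sigma>" for ws
      using alternating_abs_cong[OF oriented_chainsD(1)[OF assms(2)]] that l by metis
    \<comment> \<open>All orderings of \<sigma> carry the same absolute value, which is nonzero for
      \<open>vs\<close>, so the fibre consists of all of them.\<close>
    have "{ws. ws \<in> ?S \<and> set ws = \<sigma>} = permutations_of_set \<sigma>"
    proof -
      have "c ws \<noteq> 0" if "distinct ws" "set ws = \<sigma>" for ws
        using eq[OF that] eq[of vs] vs dist by auto
      then show ?thesis using dist by (auto simp: permutations_of_set_def)
    qed
    then have "(\<Sum>ws | ws \<in> ?S \<and> set ws = \<sigma>. \<bar>c ws\<bar>)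
        = (\<Sum>ws\<in>permutations_of_set \<sigma>. \<bar>c ?l\<bar>)"
      using eq by (intro sum.cong) (auto simp: permutations_of_set_def)
    also have "\<dots> = fact (k + 1) * \<bar>c ?l\<bar>"
      by (simp only: sum_constant card_permutations_of_set[OF card(2)] card(1) of_nat_fact)
    finally show "(\<Sum>ws | ws \<in> ?S \<and> set ws = \<sigma>. \<bar>c ws\<bar>) = fact (k + 1) * \<bar>c ?l\<bar>" .
  qed
  also have "\<dots> = fact (k + 1) * l1_norm c"
    by (simp only: l1_norm_def sum_distrib_left)
  finally show ?thesis by simp
qed

section \<open>Existence of taut fillings\<close>

text \<open>
  Subtracting from \<open>c\<close> a multiple of a direction \<open>z\<close> supported in the support of \<open>c\<close>, up to the first
  coordinate of \<open>c\<close> that vanishes, shrinks the support without increasing the norm, provided that the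
  sign of \<open>z\<close> is chosen so that the norm does not increase initially.
\<close>

lemma l1_shrink_support:
  fixes c z :: "'i \<Rightarrow> rat"
  assumes "finite I" and z: "\<And>i. z i \<noteq> 0 \<Longrightarrow> c i \<noteq> 0 \<and> i \<in> I" "z \<noteq> 0"
    and D: "(\<Sum>i\<in>I. sgn (c i) * z i) \<ge> 0"
  obtains t where "(\<Sum>i\<in>I. \<bar>c i - t * z i\<bar>) \<le> (\<Sum>i\<in>I. \<bar>c i\<bar>)"
    and "{i\<in>I. c i - t * z i \<noteq> 0} \<subset> {i\<in>I. c i \<noteq> 0}"
proof -
  \<comment> \<open>The coordinates that move towards 0 as \<open>t\<close> grows. If there were
    none, \<open>D\<close> would force every term of its sum to vanish, and hence \<open>z\<close>
    too.\<close>
  define J where "J = {i\<in>I. sgn (c i) * z i > 0}"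
  have "J \<noteq> {}"
  proof
    assume "J = {}"
    then have le: "sgn (c i) * z i \<le> 0" if "i \<in> I" for i
      using that by (force simp: J_def)
    then have "(\<Sum>i\<in>I. - (sgn (c i) * z i)) = 0"
      using D sum_nonpos[of I "\<lambda>i. sgn (c i) * z i"] by (simp add: sum_negf)
    then have "sgn (c i) * z i = 0" if "i \<in> I" for i
      using sum_nonneg_eq_0_iff[OF assms(1), of "\<lambda>i. - (sgn (c i) * z i)"] le that by simp
    then have "z i = 0" for i
      using z(1)[of i] by (auto simp: sgn_0_0)
    then show False using z(2) by auto
  qed
  moreover have "finite J" using assms(1) by (simp add: J_def)
  ultimately obtain j where j: "j \<in> J" "\<And>i. i \<in> J \<Longrightarrow> c j / z j \<le> c i / z i"
    using ex_min_if_finite[of "(\<lambda>i. c i / z i) ` J"] by (force simp: not_less)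
  \<comment> \<open>The first time at which a coordinate of \<open>c - t * z\<close> reaches 0. Up
    to then no coordinate changes sign, so each absolute value is linear in
    \<open>t\<close>.\<close>
  define t where "t = c j / z j"
  have pos: "c i / z i > 0" if "i \<in> J" for i
    using that by (auto simp: J_def sgn_if zero_less_divide_iff split: if_splits)
  have t: "t > 0" using pos[OF j(1)] by (simp add: t_def)
  have abs_eq: "\<bar>c i - t * z i\<bar> = \<bar>c i\<bar> - t * (sgn (c i) * z i)" if "i \<in> I" for i
  proof (cases "i \<in> J")
    case True
    then have "t \<le> c i / z i" using j by (simp add: t_def)
    moreover have "c i > 0 \<and> z i > 0 \<or> c i < 0 \<and> z i < 0"
      using pos[OF True] by (auto simp: zero_less_divide_iff)
    ultimately show ?thesis by (auto simp: field_simps abs_if)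
  next
    case False
    then have "sgn (c i) * z i \<le> 0" using that by (force simp: J_def)
    then have "c i > 0 \<and> z i \<le> 0 \<or> c i < 0 \<and> z i \<ge> 0 \<or> c i = 0 \<and> z i = 0"
      using z(1)[of i] by (auto simp: sgn_if split: if_splits)
    then consider "c i > 0" "t * z i \<le> 0" | "c i < 0" "t * z i \<ge> 0" | "c i = 0" "z i = 0"
      using t by (auto simp: mult_nonneg_nonpos)
    then show ?thesis by cases auto
  qed
  have "(\<Sum>i\<in>I. \<bar>c i - t * z i\<bar>) = (\<Sum>i\<in>I. \<bar>c i\<bar>) - t * (\<Sum>i\<in>I. sgn (c i) * z i)"
    using abs_eq by (simp add: sum_subtractf sum_distrib_left)
  then have 1: "(\<Sum>i\<in>I. \<bar>c i - t * z i\<bar>) \<le> (\<Sum>i\<in>I. \<bar>c i\<bar>)"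
    using t D by simp
  have "z j \<noteq> 0" "j \<in> I" using j(1) by (auto simp: J_def)
  then have "c j - t * z j = 0" "c j \<noteq> 0" "j \<in> I" using z(1)[of j] by (auto simp: t_def)
  then have "{i\<in>I. c i - t * z i \<noteq> 0} \<subset> {i\<in>I. c i \<noteq> 0}"
    using z(1) by force
  with 1 show ?thesis by (rule that)
qed

text \<open>
  Vectors of an affine space \<open>F\<close> with minimal support are determined by their support, so there are
  only finitely many of them, and every vector is dominated by one of them.
\<close>

lemma l1_min_attained:
  fixes F :: "('i \<Rightarrow> rat) set"
  assumes "finite I" "F \<noteq> {}"
    and supp: "\<And>c i. c \<in> F \<Longrightarrow> c i \<noteq> 0 \<Longrightarrow> i \<in> I"
    and aff: "\<And>c d e t. c \<in> F \<Longrightarrow> d \<in> F \<Longrightarrow> e \<in> F \<Longrightarrow> (\<lambda>i. c i - t * (d i - e i)) \<in> F"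
  shows "\<exists>c\<in>F. \<forall>d\<in>F. (\<Sum>i\<in>I. \<bar>c i\<bar>) \<le> (\<Sum>i\<in>I. \<bar>d i\<bar>)"
proof -
  define S where "S c = {i\<in>I. c i \<noteq> 0}" for c :: "'i \<Rightarrow> rat"
  define N where "N c = (\<Sum>i\<in>I. \<bar>c i\<bar>)" for c :: "'i \<Rightarrow> rat"
  define R where "R = {c\<in>F. \<forall>d\<in>F. \<forall>e\<in>F. S (\<lambda>i. d i - e i) \<subseteq> S c \<longrightarrow> d = e}"
  have dom: "\<exists>r\<in>R. N r \<le> N c" if "c \<in> F" for c
    using that
  proof (induction "card (S c)" arbitrary: c rule: less_induct)
    case less
    show ?case
    proof (cases "c \<in> R")
      case False
      then obtain d e where de: "d \<in> F" "e \<in> F" "S (\<lambda>i. d i - e i) \<subseteq> S c" "d \<noteq> e"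
        using less.prems by (auto simp: R_def)
      \<comment> \<open>Exchanging \<open>d\<close> and \<open>e\<close> reverses the direction, so
        one of the two orders has the sign required for shrinking the support.\<close>
      have "\<exists>d e. d \<in> F \<and> e \<in> F \<and> S (\<lambda>i. d i - e i) \<subseteq> S c \<and> d \<noteq> e
          \<and> (\<Sum>i\<in>I. sgn (c i) * (d i - e i)) \<ge> 0"
      proof (cases "(\<Sum>i\<in>I. sgn (c i) * (d i - e i)) \<ge> 0")
        case True
        then show ?thesis using de by blast
      next
        case False
        have "(\<Sum>i\<in>I. sgn (c i) * (e i - d i)) = - (\<Sum>i\<in>I. sgn (c i) * (d i - e i))"
          by (simp add: sum_negf[symmetric] algebra_simps)
        moreover have "S (\<lambda>i. e i - d i) \<subseteq> S c" using de(3) by (auto simp: S_def)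
        ultimately show ?thesis using de False
          by (intro exI[of _ e] exI[of _ d]) auto
      qed
      then obtain d e where de: "d \<in> F" "e \<in> F" "S (\<lambda>i. d i - e i) \<subseteq> S c" "d \<noteq> e"
        "(\<Sum>i\<in>I. sgn (c i) * (d i - e i)) \<ge> 0" by blast
      have z: "c i \<noteq> 0 \<and> i \<in> I" if "d i - e i \<noteq> 0" for i
      proof -
        have "i \<in> I" using that supp[OF de(1), of i] supp[OF de(2), of i] by force
        then show ?thesis using that de(3) by (auto simp: S_def)
      qed
      have nz: "(\<lambda>i. d i - e i) \<noteq> 0" using de(4) by (auto simp: fun_eq_iff)
      obtain t where t: "N (\<lambda>i. c i - t * (d i - e i)) \<le> N c"
        "S (\<lambda>i. c i - t * (d i - e i)) \<subset> S c"
        unfolding N_def S_def by (rule l1_shrink_support[OF assms(1) z nz de(5)])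
      let ?c = "\<lambda>i. c i - t * (d i - e i)"
      have "finite (S c)" using assms(1) by (simp add: S_def)
      then have "card (S ?c) < card (S c)" using t(2) by (rule psubset_card_mono)
      then obtain r where "r \<in> R" "N r \<le> N ?c"
        using less.hyps[OF _ aff[OF less.prems de(1,2), of t]] by blast
      then show ?thesis using t(1) by (meson order_trans)
    qed auto
  qed
  have "inj_on S R"
  proof
    fix c d assume cd: "c \<in> R" "d \<in> R" "S c = S d"
    then have "S (\<lambda>i. c i - d i) \<subseteq> S c" by (fastforce simp: S_def)
    then show "c = d" using cd by (auto simp: R_def)
  qed
  moreover have "S ` R \<subseteq> Pow I" by (auto simp: S_def)
  ultimately have "finite R"
    using assms(1) by (meson finite_Pow_iff finite_imageD finite_subset)
  moreover have "R \<noteq> {}" using dom assms(2) by blast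
  ultimately obtain c where c: "c \<in> R" "\<And>r. r \<in> R \<Longrightarrow> N c \<le> N r"
    using ex_min_if_finite[of "N ` R"] by (force simp: not_less)
  have "N c \<le> N d" if "d \<in> F" for d
    using dom[OF that] c(2) by (meson order_trans)
  moreover have "c \<in> F" using c(1) by (simp add: R_def)
  ultimately show ?thesis unfolding N_def by blast
qed

section \<open>Cones and the existence of fillings\<close>

text \<open>Both sides are alternating in \<open>ws\<close> and take the value 1 at
  \<open>us\<close>; away from the reorderings of \<open>us\<close> both vanish. This reads off the
  coefficients of a cone at tuples starting with the apex.\<close>

lemma oriented_simplex_Cons:
  assumes "distinct (x # us)"
  shows "oriented_simplex (x # us) (x # ws) = oriented_simplex us ws"
proof (cases "mset ws = mset us")
  case True
  have "distinct us" "distinct ws" "set us = set ws"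
    using assms mset_eq_imp_distinct_iff[OF True] mset_eq_setD[OF True] by auto
  moreover have "oriented_simplex (x # us) (x # us) = oriented_simplex us us"
    using oriented_simplex_self[OF assms] oriented_simplex_self[of us] assms by simp
  ultimately show ?thesis
    by (intro alternating_eqI[of "\<lambda>ws. oriented_simplex (x # us) (x # ws)" "oriented_simplex us" us ws]
        alternating_Cons alternating_oriented_simplex assms)
next
  case False
  then show ?thesis by (simp add: oriented_simplex_eq_0)
qed

text \<open>The cone \<open>K\<close> with apex \<open>c\<close> is taken over the simplices of
  \<open>X\<close> that avoid \<open>c\<close>. Faces without \<open>c\<close> receive the
  coefficients of \<open>X\<close> directly; faces through \<open>c\<close> come out right because
  \<open>X\<close> is a cycle.\<close>

lemma cone_filling:
  assumes "finite \<Omega>" "c \<in> \<Omega>" and X: "X \<in> cycles \<Omega> n"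
  obtains K where "K \<in> fillings \<Omega> n X"
proof -
  have Xc: "X \<in> oriented_chains \<Omega> n" "boundary \<Omega> X = 0"
    using X by (auto simp: cycles_def)
  define l :: "'a set \<Rightarrow> 'a list" where "l \<sigma> = (SOME vs. distinct vs \<and> set vs = \<sigma>)" for \<sigma>
  have l: "distinct (l \<sigma>) \<and> set (l \<sigma>) = \<sigma>" if "\<sigma> \<subseteq> \<Omega>" for \<sigma>
  proof -
    have "\<exists>vs. distinct vs \<and> set vs = \<sigma>"
      using finite_distinct_list[OF finite_subset[OF that assms(1)]] by blast
    then show ?thesis unfolding l_def by (rule someI_ex)
  qed
  define T where "T = {\<sigma>. \<sigma> \<subseteq> \<Omega> \<and> card \<sigma> = n + 1}"
  define K where "K = (\<lambda>vs. \<Sum>\<sigma>\<in>{\<sigma>\<in>T. c \<notin> \<sigma>}. X (l \<sigma>) * oriented_simplex (c # l \<sigma>) vs)"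
  have finT: "finite T" using assms(1) by (simp add: T_def)
  have simplex: "oriented_simplex (c # l \<sigma>) \<in> oriented_chains \<Omega> (n + 1)" if "\<sigma> \<in> T" "c \<notin> \<sigma>" for \<sigma>
  proof -
    have "distinct (l \<sigma>)" "set (l \<sigma>) = \<sigma>" "length (l \<sigma>) = n + 1"
      using that l[of \<sigma>] distinct_card[of "l \<sigma>"] by (auto simp: T_def)
    then show ?thesis
      using that assms(2) by (intro oriented_simplex_in_chains) (auto simp: T_def)
  qed
  have altK: "alternating K"
    unfolding K_def using simplex by (intro alternating_sum oriented_chainsD(1)) auto
  have supp: "\<exists>\<sigma>. \<sigma> \<in> T \<and> c \<notin> \<sigma> \<and> oriented_simplex (c # l \<sigma>) vs \<noteq> 0" if "K vs \<noteq> 0" for vs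
  proof (rule ccontr)
    assume "\<not> ?thesis"
    then have "K vs = 0" unfolding K_def by (intro sum.neutral) auto
    then show False using that by simp
  qed
  have chainK: "K \<in> oriented_chains \<Omega> (n + 1)"
    using altK supp simplex oriented_chainsD(2) by (intro oriented_chainsI) blast+
  have K_0: "K vs = 0" if "c \<notin> set vs" for vs
  proof (rule ccontr)
    assume "K vs \<noteq> 0"
    then obtain \<sigma> where "mset vs = mset (c # l \<sigma>)"
      using supp oriented_simplex_eq_0 by metis
    then show False using that by (metis list.set_intros(1) mset_eq_setD)
  qed
  have K_c: "K (c # ws) = X ws" if "c \<notin> set ws" for ws
  proof -
    have "K (c # ws) = (\<Sum>\<sigma>\<in>{\<sigma>\<in>T. c \<notin> \<sigma>}. X (l \<sigma>) * oriented_simplex (l \<sigma>) ws)"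
      unfolding K_def
    proof (rule sum.cong[OF refl])
      fix \<sigma> assume "\<sigma> \<in> {\<sigma>\<in>T. c \<notin> \<sigma>}"
      then have "distinct (c # l \<sigma>)" using l[of \<sigma>] by (auto simp: T_def)
      then show "X (l \<sigma>) * oriented_simplex (c # l \<sigma>) (c # ws) = X (l \<sigma>) * oriented_simplex (l \<sigma>) ws"
        by (simp only: oriented_simplex_Cons)
    qed
    \<comment> \<open>Simplices through \<open>c\<close> contribute nothing at a tuple avoiding
      \<open>c\<close>, so they may be included to obtain the full expansion of
      \<open>X\<close>.\<close>
    also have "\<dots> = (\<Sum>\<sigma>\<in>T. X (l \<sigma>) * oriented_simplex (l \<sigma>) ws)"
    proof (rule sum.mono_neutral_left[OF finT], blast, rule ballI)
      fix \<sigma> assume "\<sigma> \<in> T - {\<sigma>\<in>T. c \<notin> \<sigma>}"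
      then have "c \<in> set (l \<sigma>)" using l[of \<sigma>] by (auto simp: T_def)
      then have "mset ws \<noteq> mset (l \<sigma>)" using that mset_eq_setD by metis
      then show "X (l \<sigma>) * oriented_simplex (l \<sigma>) ws = 0" by (simp add: oriented_simplex_eq_0)
    qed
    also have "\<dots> = X ws"
      using chain_expansion[OF assms(1) Xc(1) l] unfolding T_def by (rule fun_cong[symmetric])
    finally show ?thesis .
  qed
  have front: "boundary \<Omega> K (c # ts) = X (c # ts)" for ts
  proof (cases "c \<in> set ts")
    case True
    then show ?thesis
      using alternating_eq_0[OF alternating_boundary[OF altK]] alternating_eq_0[OF oriented_chainsD(1)[OF Xc(1)]]
      by simp
  next
    case False
    have swap: "K (x # c # ts) = (if x = c then 0 else - X (x # ts))" for x
      using alternating_move_to_front[OF altK, of "[x]" c ts] False K_c[of "x # ts"]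
        alternating_eq_0[OF altK, of "c # c # ts"] by auto
    have "boundary \<Omega> K (c # ts) = (\<Sum>x\<in>\<Omega> - {c}. - X (x # ts))"
      unfolding boundary_def swap using assms(1) by (intro sum.mono_neutral_cong_right) auto
    \<comment> \<open>The sum over all vertices other than \<open>c\<close> is the boundary of
      \<open>X\<close> at \<open>ts\<close> without its term for \<open>c\<close>.\<close>
    also have "\<dots> = X (c # ts) - boundary \<Omega> X ts"
      unfolding boundary_def using assms(1,2) by (simp add: sum.remove sum_negf)
    finally show ?thesis using Xc(2) by simp
  qed
  have "boundary \<Omega> K ws = X ws" for ws
  proof (cases "c \<in> set ws")
    case True
    then obtain us vs where ws: "ws = us @ c # vs" by (metis split_list)
    show ?thesis
      unfolding ws alternating_move_to_front[OF alternating_boundary[OF altK]]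
        alternating_move_to_front[OF oriented_chainsD(1)[OF Xc(1)]] front ..
  next
    case False
    then have "K (x # ws) = 0" if "x \<noteq> c" for x
      using K_0[of "x # ws"] that by simp
    then have "boundary \<Omega> K ws = K (c # ws)"
      unfolding boundary_def using assms(1,2)
      by (subst sum.mono_neutral_right[of \<Omega> "{c}"]) auto
    then show ?thesis using K_c[OF False] by simp
  qed
  then have "boundary \<Omega> K = X" by (rule ext)
  then show ?thesis using chainK that by (auto simp: fillings_def)
qed

lemma fillings_nonempty:
  assumes "finite \<Omega>" "X \<in> cycles \<Omega> n"
  shows "fillings \<Omega> n X \<noteq> {}"
proof (cases "\<Omega> = {}")
  \<comment> \<open>There is no apex for a cone here, but no nonempty tuple exists either, so
    \<open>X\<close> is zero and the zero chain fills it.\<close>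
  case True
  have "0 \<in> oriented_chains \<Omega> (n + 1)" by (intro oriented_chainsI) (auto simp: alternating_def)
  moreover have "X = 0"
    using assms True oriented_chainsD(2)[of X \<Omega> n] by (fastforce simp: cycles_def tuples_def)
  moreover have "boundary \<Omega> 0 = 0" by (auto simp: boundary_def)
  ultimately show ?thesis unfolding fillings_def by blast
next
  case False
  then show ?thesis using cone_filling[OF assms(1) _ assms(2)] by blast
qed

section \<open>Minimal fillings and their norm\<close>

lemma l1_norm_le_iff:
  assumes "finite \<Omega>" "c \<in> oriented_chains \<Omega> k" "d \<in> oriented_chains \<Omega> k"
  shows "l1_norm c \<le> l1_norm d \<longleftrightarrow>
    (\<Sum>vs\<in>tuples \<Omega> (k + 1). \<bar>c vs\<bar>) \<le> (\<Sum>vs\<in>tuples \<Omega> (k + 1). \<bar>d vs\<bar>)"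
  unfolding l1_norm_eq_sum_tuples[OF assms(1,2), symmetric] l1_norm_eq_sum_tuples[OF assms(1,3), symmetric]
  by (rule mult_le_cancel_left_pos[symmetric]) (rule fact_gt_zero)

text \<open>The fillings form a nonempty affine space with finitely many coordinates, and the norm
  is a constant multiple of the sum of absolute values over these coordinates.\<close>

lemma min_filling:
  assumes "finite \<Omega>" "X \<in> cycles \<Omega> n"
  shows "\<exists>M\<in>fillings \<Omega> n X. \<forall>M'\<in>fillings \<Omega> n X. l1_norm M \<le> l1_norm M'"
proof -
  let ?I = "tuples \<Omega> (n + 1 + 1)"
  have aff: "(\<lambda>vs. c vs - t * (d vs - e vs)) \<in> fillings \<Omega> n X"
    if c: "c \<in> fillings \<Omega> n X" and d: "d \<in> fillings \<Omega> n X" and e: "e \<in> fillings \<Omega> n X" for c d e t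
  proof -
    have "(\<lambda>vs. 1 * c vs + (- t) * (1 * d vs + (- 1) * e vs)) \<in> oriented_chains \<Omega> (n + 1)"
      using c d e by (intro chains_combine) (auto simp: fillings_def)
    moreover have "boundary \<Omega> (\<lambda>vs. c vs - t * (d vs - e vs)) ws
        = boundary \<Omega> c ws - t * (boundary \<Omega> d ws - boundary \<Omega> e ws)" for ws
      by (simp add: boundary_def sum_subtractf sum_distrib_left right_diff_distrib)
    ultimately show ?thesis using c d e by (auto simp: fillings_def algebra_simps)
  qed
  have "i \<in> ?I" if "c \<in> fillings \<Omega> n X" "c i \<noteq> 0" for c i
    using that oriented_chainsD(2)[of c \<Omega> "n + 1" i] by (auto simp: fillings_def)
  then have "\<exists>M\<in>fillings \<Omega> n X. \<forall>M'\<in>fillings \<Omega> n X. (\<Sum>vs\<in>?I. \<bar>M vs\<bar>) \<le> (\<Sum>vs\<in>?I. \<bar>M' vs\<bar>)"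
    by (rule l1_min_attained[OF finite_tuples[OF assms(1)] fillings_nonempty[OF assms] _ aff])
  moreover have "l1_norm M \<le> l1_norm M' \<longleftrightarrow> (\<Sum>vs\<in>?I. \<bar>M vs\<bar>) \<le> (\<Sum>vs\<in>?I. \<bar>M' vs\<bar>)"
    if "M \<in> fillings \<Omega> n X" "M' \<in> fillings \<Omega> n X" for M M'
    using that unfolding fillings_def by (intro l1_norm_le_iff[OF assms(1)]) auto
  ultimately show ?thesis by meson
qed

text \<open>The rationals are not well-ordered, so \<open>LEAST\<close> is evaluated by exhibiting a
  minimiser.\<close>

lemma Qvol_eq:
  assumes "M \<in> fillings \<Omega> n X" "\<And>M'. M' \<in> fillings \<Omega> n X \<Longrightarrow> l1_norm M \<le> l1_norm M'"
  shows "Qvol \<Omega> n X = l1_norm M"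
  unfolding Qvol_def using assms by (intro Least_equality) auto

lemma Qvol_le:
  assumes "finite \<Omega>" "X \<in> cycles \<Omega> n" "M \<in> fillings \<Omega> n X"
  shows "Qvol \<Omega> n X \<le> l1_norm M"
proof -
  obtain M' where "M' \<in> fillings \<Omega> n X" "\<forall>N\<in>fillings \<Omega> n X. l1_norm M' \<le> l1_norm N"
    using min_filling[OF assms(1,2)] by blast
  then show ?thesis using Qvol_eq[of M'] assms(3) by simp
qed

lemma taut_filling_exists:
  assumes "finite \<Omega>" "X \<in> cycles \<Omega> n"
  obtains M where "taut_filling \<Omega> n X M"
proof -
  obtain M where "M \<in> fillings \<Omega> n X" "\<forall>M'\<in>fillings \<Omega> n X. l1_norm M \<le> l1_norm M'"
    using min_filling[OF assms] by blast
  then show ?thesis using that Qvol_eq[of M] by (simp add: taut_filling_def)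
qed

section \<open>Simplicial maps\<close>

text \<open>The chain map induced by the vertex map \<open>f\<close>. Degenerate images need no
  separate clause: for alternating \<open>c\<close> the contributions to a tuple with a repeated
  entry cancel.\<close>

definition push :: "'a set \<Rightarrow> ('a \<Rightarrow> 'a) \<Rightarrow> ('a list \<Rightarrow> rat) \<Rightarrow> ('a list \<Rightarrow> rat)" where
  "push \<Omega> f c = (\<lambda>ws. \<Sum>vs | vs \<in> tuples \<Omega> (length ws) \<and> map f vs = ws. c vs)"

lemma push_add: "push \<Omega> f (c + d) = push \<Omega> f c + push \<Omega> f d"
  by (auto simp: push_def sum.distrib)

text \<open>Permuting entries commutes with \<open>map f\<close>, so a permutation carries the fibre
  over \<open>ws\<close> bijectively to the fibre over the permuted tuple.\<close>

lemma alternating_push: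
  assumes "alternating c"
  shows "alternating (push \<Omega> f c)"
  unfolding alternating_def
proof (intro allI impI)
  fix ws :: "'a list" and p assume p: "p permutes {..<length ws}"
  have inv: "inv p permutes {..<length ws}" using p by (rule permutes_inv)
  have cancel: "permute_list (inv p) (permute_list p vs) = vs" "permute_list p (permute_list (inv p) vs) = vs"
    if "length vs = length ws" for vs :: "'a list"
    using p inv that permute_list_compose[of "inv p" vs p] permute_list_compose[of p vs "inv p"]
    by (simp_all add: permutes_inv_o)
  have sgn: "of_int (sign p) * c (permute_list (inv p) vs) = c vs" if "length vs = length ws" for vs
    using alternatingD[OF assms, of p "permute_list (inv p) vs"] p cancel(2)[OF that] that by simp
  have "push \<Omega> f c (permute_list p ws)
      = (\<Sum>vs | vs \<in> tuples \<Omega> (length ws) \<and> map f vs = permute_list p ws. c vs)"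
    by (simp add: push_def)
  also have "\<dots> = (\<Sum>vs | vs \<in> tuples \<Omega> (length ws) \<and> map f vs = ws. of_int (sign p) * c vs)"
    using p inv cancel sgn
    by (intro sum.reindex_bij_witness[of _ "permute_list p" "permute_list (inv p)"])
       (auto simp: tuples_def permute_list_map[symmetric])
  finally show "push \<Omega> f c (permute_list p ws) = of_int (sign p) * push \<Omega> f c ws"
    by (simp add: push_def sum_distrib_left)
qed

lemma push_supp:
  assumes "push \<Omega> f c ws \<noteq> 0"
  obtains vs where "vs \<in> tuples \<Omega> (length ws)" "map f vs = ws" "c vs \<noteq> 0"
  using assms that unfolding push_def by (elim sum.not_neutral_contains_not_neutral) blast

lemma push_chain:
  assumes "c \<in> oriented_chains \<Omega> k" "f ` \<Omega> \<subseteq> \<Omega>"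
  shows "push \<Omega> f c \<in> oriented_chains \<Omega> k"
proof (rule oriented_chainsI)
  show "alternating (push \<Omega> f c)" using assms(1) by (intro alternating_push oriented_chainsD(1))
  fix ws assume "push \<Omega> f c ws \<noteq> 0"
  then obtain vs where "map f vs = ws" "c vs \<noteq> 0" by (rule push_supp)
  then show "ws \<in> tuples \<Omega> (k + 1)"
    using oriented_chainsD(2)[OF assms(1), of vs] assms(2) by (fastforce simp: tuples_def)
qed

text \<open>A preimage of \<open>x # ws\<close> is a preimage of \<open>x\<close> followed by one of
  \<open>ws\<close>. As \<open>x\<close> runs through \<Omega>, the preimages of \<open>x\<close>
  partition \<Omega>.\<close>

lemma boundary_push:
  assumes "finite \<Omega>" "f ` \<Omega> \<subseteq> \<Omega>"
  shows "boundary \<Omega> (push \<Omega> f c) = push \<Omega> f (boundary \<Omega> c)"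
proof
  fix ws
  let ?U = "{us. us \<in> tuples \<Omega> (length ws) \<and> map f us = ws}"
  have "push \<Omega> f c (x # ws) = (\<Sum>y | y \<in> \<Omega> \<and> f y = x. \<Sum>us\<in>?U. c (y # us))" for x
  proof -
    have "push \<Omega> f c (x # ws) = (\<Sum>(y, us)\<in>{y. y \<in> \<Omega> \<and> f y = x} \<times> ?U. c (y # us))"
      unfolding push_def
      by (rule sum.reindex_bij_witness[of _ "\<lambda>(y, us). y # us" "\<lambda>vs. (hd vs, tl vs)"])
         (auto simp: tuples_def)
    then show ?thesis by (simp add: sum.cartesian_product)
  qed
  then have "boundary \<Omega> (push \<Omega> f c) ws = (\<Sum>x\<in>\<Omega>. \<Sum>y | y \<in> \<Omega> \<and> f y = x. \<Sum>us\<in>?U. c (y # us))"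
    by (simp add: boundary_def)
  also have "\<dots> = (\<Sum>y\<in>\<Omega>. \<Sum>us\<in>?U. c (y # us))"
    using assms by (intro sum.group) auto
  also have "\<dots> = push \<Omega> f (boundary \<Omega> c) ws"
    unfolding push_def boundary_def by (rule sum.swap)
  finally show "boundary \<Omega> (push \<Omega> f c) ws = push \<Omega> f (boundary \<Omega> c) ws" .
qed

lemma push_fixed:
  assumes "finite \<Omega>" "c \<in> oriented_chains \<Omega> k" "\<And>x. x \<in> Vert c \<Longrightarrow> f x = x"
  shows "push \<Omega> f c = c"
proof
  fix ws
  have fixed: "map f vs = vs" if "c vs \<noteq> 0" for vs
    using set_subset_Vert[of c vs] that assms(3) by (auto intro: map_idI)
  let ?V = "{vs. vs \<in> tuples \<Omega> (length ws) \<and> map f vs = ws}"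
  have "finite ?V" using assms(1) by simp
  then have "push \<Omega> f c ws = (\<Sum>vs\<in>?V \<inter> {ws}. c vs)"
    unfolding push_def using fixed by (intro sum.mono_neutral_right) auto
  also have "\<dots> = c ws"
    using fixed[of ws] oriented_chainsD(2)[OF assms(2), of ws] by (cases "c ws = 0") (auto simp: tuples_def)
  finally show "push \<Omega> f c ws = c ws" .
qed

text \<open>Triangle inequality on each fibre. Over a distinct tuple only simplices mapped
  injectively occur, and elsewhere the pushforward vanishes. Discarding the degenerate simplices is
  what later allows two such bounds to be added.\<close>

lemma push_norm_le:
  assumes "finite \<Omega>" "c \<in> oriented_chains \<Omega> k" "f ` \<Omega> \<subseteq> \<Omega>"
  shows "(\<Sum>ws\<in>tuples \<Omega> m. \<bar>push \<Omega> f c ws\<bar>)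
    \<le> (\<Sum>vs\<in>tuples \<Omega> m. if inj_on f (set vs) then \<bar>c vs\<bar> else 0)"
proof -
  let ?g = "\<lambda>vs. if inj_on f (set vs) then \<bar>c vs\<bar> else 0"
  have fin: "finite (tuples \<Omega> m)" using assms(1) by simp
  have "\<bar>push \<Omega> f c ws\<bar> \<le> (\<Sum>vs | vs \<in> tuples \<Omega> m \<and> map f vs = ws. ?g vs)" if "ws \<in> tuples \<Omega> m" for ws
  proof (cases "distinct ws")
    case True
    have "\<bar>push \<Omega> f c ws\<bar> \<le> (\<Sum>vs | vs \<in> tuples \<Omega> m \<and> map f vs = ws. \<bar>c vs\<bar>)"
      using that unfolding push_def tuples_def by (auto intro: order_trans[OF sum_abs])
    also have "\<dots> = (\<Sum>vs | vs \<in> tuples \<Omega> m \<and> map f vs = ws. ?g vs)"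
      using True by (intro sum.cong) (auto simp: distinct_map)
    finally show ?thesis .
  next
    case False
    then have "push \<Omega> f c ws = 0"
      using oriented_chainsD(1)[OF assms(2)] by (intro alternating_eq_0 alternating_push)
    then show ?thesis by (simp add: sum_nonneg)
  qed
  then have "(\<Sum>ws\<in>tuples \<Omega> m. \<bar>push \<Omega> f c ws\<bar>)
      \<le> (\<Sum>ws\<in>tuples \<Omega> m. \<Sum>vs | vs \<in> tuples \<Omega> m \<and> map f vs = ws. ?g vs)"
    by (rule sum_mono)
  also have "\<dots> = (\<Sum>vs\<in>tuples \<Omega> m. ?g vs)"
    using assms(3) by (intro sum.group fin) (fastforce simp: tuples_def)
  finally show ?thesis .
qed

section \<open>Collapsing the complement of a vertex set\<close>

text \<open>A retraction onto \<open>A\<close> if \<open>c\<close> lies in \<open>A\<close>; the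
  target may also lie outside \<open>A\<close>, which is allowed for when the two cycles share no
  vertex.\<close>

definition collapse :: "'a set \<Rightarrow> 'a \<Rightarrow> 'a \<Rightarrow> 'a" where
  "collapse A c v = (if v \<in> A then v else c)"

text \<open>All vertices outside \<open>A\<close> share the image \<open>c\<close>, so injectivity
  permits one of them, and none if \<open>c\<close> is itself a vertex of \<sigma> fixed by the
  collapse.\<close>

lemma inj_on_collapseD:
  assumes "inj_on (collapse A c) \<sigma>"
  shows "card (\<sigma> - A) \<le> 1" "c \<in> A \<Longrightarrow> c \<in> \<sigma> \<Longrightarrow> \<sigma> \<subseteq> A"
proof -
  have "inj_on (collapse A c) (\<sigma> - A)" using assms by (rule inj_on_subset) blast
  then show "card (\<sigma> - A) \<le> 1"
    using card_inj_on_le[of "collapse A c" "\<sigma> - A" "{c}"] by (auto simp: collapse_def)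
  show "\<sigma> \<subseteq> A" if "c \<in> A" "c \<in> \<sigma>"
  proof
    fix v assume "v \<in> \<sigma>"
    then show "v \<in> A"
      using inj_onD[OF assms, of v c] that by (cases "v \<in> A") (simp_all add: collapse_def)
  qed
qed

lemma push_collapse_filling:
  assumes fin: "finite \<Omega>" and X: "X \<in> cycles \<Omega> n" and Y: "Y \<in> cycles \<Omega> n"
    and M: "M \<in> fillings \<Omega> n (X + Y)"
    and c: "\<Omega> = {} \<or> c \<in> \<Omega>" "Vert X \<inter> Vert Y = {} \<or> c \<in> Vert X \<inter> Vert Y"
    and card: "card (Vert X \<inter> Vert Y) \<le> n + 1"
  shows "push \<Omega> (collapse (Vert X) c) M \<in> fillings \<Omega> n X"
proof -
  let ?f = "collapse (Vert X) c"
  have XY: "X \<in> oriented_chains \<Omega> n" "boundary \<Omega> X = 0" "Y \<in> oriented_chains \<Omega> n" "boundary \<Omega> Y = 0"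
    using X Y by (auto simp: cycles_def)
  have f: "?f ` \<Omega> \<subseteq> \<Omega>" using c(1) by (auto simp: collapse_def)
  have "push \<Omega> ?f X = X"
    by (rule push_fixed[OF fin XY(1)]) (simp add: collapse_def)
  moreover have "push \<Omega> ?f Y = 0"
  proof (rule cycle_on_few_vertices[OF fin push_chain[OF XY(3) f]])
    show "boundary \<Omega> (push \<Omega> ?f Y) = 0"
      unfolding boundary_push[OF fin f] XY(4) by (auto simp: push_def)
    show "Vert (push \<Omega> ?f Y) \<subseteq> insert c (Vert X \<inter> Vert Y)"
    proof
      fix v assume "v \<in> Vert (push \<Omega> ?f Y)"
      then obtain ws where ws: "push \<Omega> ?f Y ws \<noteq> 0" "v \<in> set ws" by (auto simp: Vert_def)
      then obtain vs where "map ?f vs = ws" "Y vs \<noteq> 0" by (auto elim: push_supp)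
      then show "v \<in> insert c (Vert X \<inter> Vert Y)"
        using ws(2) set_subset_Vert[of Y vs] by (auto simp: collapse_def)
    qed
    show "finite (insert c (Vert X \<inter> Vert Y))"
      using Vert_subset[OF XY(1)] fin by (auto intro: finite_subset)
    \<comment> \<open>Either \<open>c\<close> is already a common vertex, or there are no common
      vertices and the set is the singleton of \<open>c\<close>.\<close>
    show "card (insert c (Vert X \<inter> Vert Y)) \<le> n + 1"
      using c(2) card by (auto simp: insert_absorb)
  qed
  ultimately have "boundary \<Omega> (push \<Omega> ?f M) = X"
    using M by (simp add: boundary_push[OF fin f] fillings_def push_add)
  then show ?thesis
    using M push_chain[OF _ f] by (auto simp: fillings_def)
qed

section \<open>Splitting a filling\<close>

text \<open>The clauses ensure that both collapses map \<Omega> to itself, that the targets are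
  common vertices whenever there are any, and that they differ in the extremal case of
  \<open>n + 1\<close> common vertices.\<close>

definition admissible :: "'a set \<Rightarrow> 'a set \<Rightarrow> 'a set \<Rightarrow> nat \<Rightarrow> 'a \<Rightarrow> 'a \<Rightarrow> bool" where
  "admissible \<Omega> A B n c d \<longleftrightarrow> (\<Omega> = {} \<or> c \<in> \<Omega> \<and> d \<in> \<Omega>)
     \<and> (A \<inter> B = {} \<or> c \<in> A \<inter> B \<and> d \<in> A \<inter> B) \<and> (c \<noteq> d \<or> card (A \<inter> B) \<le> n)"

lemma admissibleI:
  "A \<subseteq> \<Omega> \<Longrightarrow> c \<in> A \<inter> B \<Longrightarrow> d \<in> A \<inter> B \<Longrightarrow> c \<noteq> d \<or> card (A \<inter> B) \<le> n \<Longrightarrow> admissible \<Omega> A B n c d"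
  by (auto simp: admissible_def)

lemma ex_other_element:
  assumes "card S \<ge> 2"
  obtains y where "y \<in> S" "y \<noteq> x"
proof -
  have "\<not> S \<subseteq> {x}" using assms card_mono[of "{x}" S] by auto
  then show ?thesis using that by blast
qed

text \<open>One common vertex serves as both targets unless there are more than \<open>n\<close>;
  then there are at least two, as \<open_placeholder>\<close>

lemma admissible_exists:
  assumes "A \<subseteq> \<Omega>" "n \<ge> 1"
  obtains c d where "admissible \<Omega> A B n c d"
proof (cases "A \<inter> B = {}")
  case True
  obtain c where "\<Omega> = {} \<or> c \<in> \<Omega>" by blast
  then show ?thesis using True by (intro that[of c c]) (auto simp: admissible_def)
next
  case False
  then obtain c where c: "c \<in> A \<inter> B" by blast
  show ?thesis
  proof (cases "card (A \<inter> B) \<le> n")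
    case True
    then show ?thesis using assms c by (intro that[of c c] admissibleI) auto
  next
    case False
    then obtain d where "d \<in> A \<inter> B" "d \<noteq> c"
      using assms(2) ex_other_element[of "A \<inter> B" c] by auto
    then show ?thesis using assms c by (intro that[of c d] admissibleI) auto
  qed
qed

lemma card_le_parts:
  assumes "finite \<sigma>"
  shows "card \<sigma> \<le> card (\<sigma> - A) + card (\<sigma> - B) + card (\<sigma> \<inter> (A \<inter> B))"
proof -
  have "\<sigma> = (\<sigma> - A) \<union> (\<sigma> - B) \<union> (\<sigma> \<inter> (A \<inter> B))" by blast
  then show ?thesis
    using card_Un_le[of "\<sigma> - A" "\<sigma> - B"] card_Un_le[of "(\<sigma> - A) \<union> (\<sigma> - B)" "\<sigma> \<inter> (A \<inter> B)"] by simp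
qed

text \<open>
  A simplex on which both collapses are injective has at most one vertex outside \<open>A\<close> and at most one
  outside \<open>B\<close>, hence at least \<open>n\<close> vertices in \<open>A \<inter> B\<close>, while it avoids \<open>c\<close> and \<open>d\<close>.
\<close>

lemma collapse_not_both:
  assumes "finite (A \<inter> B)" "n \<ge> 1" "card (A \<inter> B) \<le> n + 1" "card \<sigma> = n + 2"
    and adm: "admissible \<Omega> A B n c d"
  shows "\<not> (inj_on (collapse A c) \<sigma> \<and> inj_on (collapse B d) \<sigma>)"
proof
  assume "inj_on (collapse A c) \<sigma> \<and> inj_on (collapse B d) \<sigma>"
  then have inj: "inj_on (collapse A c) \<sigma>" "inj_on (collapse B d) \<sigma>" by blast+
  let ?C = "A \<inter> B"
  have fin: "finite \<sigma>" using assms(4) by (metis card.infinite add_is_0 zero_neq_numeral)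
  have a: "card (\<sigma> - A) \<le> 1" and b: "card (\<sigma> - B) \<le> 1"
    by (rule inj_on_collapseD(1)[OF inj(1)], rule inj_on_collapseD(1)[OF inj(2)])
  have parts: "n + 2 \<le> card (\<sigma> - A) + card (\<sigma> - B) + card (\<sigma> \<inter> ?C)"
    using card_le_parts[OF fin, of A B] assms(4) by simp
  then have k: "n \<le> card (\<sigma> \<inter> ?C)" using a b by simp
  then have "?C \<noteq> {}" using assms(2) by auto
  then have cd: "c \<in> ?C" "d \<in> ?C" "c \<noteq> d \<or> card ?C \<le> n"
    using adm by (auto simp: admissible_def)
  have full: "?C \<subseteq> \<sigma>" if "n + 1 \<le> card (\<sigma> \<inter> ?C)"
    using card_seteq[of ?C "\<sigma> \<inter> ?C"] that assms(1,3) by auto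
  have not_sub: "\<not> (\<sigma> \<subseteq> A \<and> \<sigma> \<subseteq> B)"
  proof
    assume "\<sigma> \<subseteq> A \<and> \<sigma> \<subseteq> B"
    then have "card \<sigma> \<le> card ?C" using assms(1) by (intro card_mono) auto
    then show False using assms(3,4) by simp
  qed
  have "\<not> \<sigma> \<subseteq> A"
  proof
    assume "\<sigma> \<subseteq> A"
    then have "card (\<sigma> - A) = 0" by (simp add: Diff_eq_empty_iff[THEN iffD2])
    then have "n + 1 \<le> card (\<sigma> \<inter> ?C)" using parts b by simp
    then have "\<sigma> \<subseteq> B" using full cd(2) inj_on_collapseD(2)[OF inj(2)] by blast
    then show False using \<open>\<sigma> \<subseteq> A\<close> not_sub by blast
  qed
  moreover have "\<not> \<sigma> \<subseteq> B"
  proof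
    assume "\<sigma> \<subseteq> B"
    then have "card (\<sigma> - B) = 0" by (simp add: Diff_eq_empty_iff[THEN iffD2])
    then have "n + 1 \<le> card (\<sigma> \<inter> ?C)" using parts a by simp
    then have "\<sigma> \<subseteq> A" using full cd(1) inj_on_collapseD(2)[OF inj(1)] by blast
    then show False using \<open>\<sigma> \<subseteq> B\<close> not_sub by blast
  qed
  ultimately have "\<sigma> \<inter> ?C \<subseteq> ?C - {c, d}"
    using cd inj_on_collapseD(2)[OF inj(1)] inj_on_collapseD(2)[OF inj(2)] by blast
  then have "card (\<sigma> \<inter> ?C) \<le> card (?C - {c, d})"
    using assms(1) by (intro card_mono) auto
  moreover have "card (?C - {c, d}) = card ?C - card {c, d}"
    using cd assms(1) by (intro card_Diff_subset) auto
  moreover have "card ?C - card {c, d} < n"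
    using cd(3) assms(2,3) by (cases "c = d") auto
  ultimately show False using k by simp
qed

lemma collapse_always_one:
  assumes "A \<subseteq> \<Omega>" "finite \<sigma>" "n \<ge> 2" "card \<sigma> = n + 2"
    and inj: "\<And>c d. admissible \<Omega> A B n c d \<Longrightarrow> inj_on (collapse A c) \<sigma> \<or> inj_on (collapse B d) \<sigma>"
  shows "\<sigma> \<subseteq> A \<or> \<sigma> \<subseteq> B \<or> \<sigma> \<inter> (A \<inter> B) = {} \<and> (card (\<sigma> - A) = 1 \<or> card (\<sigma> - B) = 1)"
proof (rule ccontr)
  assume neg: "\<not> ?thesis"
  have a: "\<sigma> - A \<noteq> {}" and b: "\<sigma> - B \<noteq> {}" using neg by blast+
  have one: "card (\<sigma> - A) = 1 \<and> (c \<in> A \<longrightarrow> c \<notin> \<sigma>) \<or> card (\<sigma> - B) = 1 \<and> (d \<in> B \<longrightarrow> d \<notin> \<sigma>)"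
    if adm: "admissible \<Omega> A B n c d" for c d
  proof -
    have "card (\<sigma> - A) \<noteq> 0" "card (\<sigma> - B) \<noteq> 0" using a b assms(2) by auto
    then show ?thesis
      using inj[OF adm] inj_on_collapseD[of A c \<sigma>] inj_on_collapseD[of B d \<sigma>] a b by fastforce
  qed
  show False
  proof (cases "\<sigma> \<inter> (A \<inter> B) = {}")
    case True
    obtain c d where "admissible \<Omega> A B n c d"
      using admissible_exists[OF assms(1)] assms(3) by (metis le_trans one_le_numeral)
    then show False using one neg True by blast
  next
    case False
    then obtain x where x: "x \<in> \<sigma>" "x \<in> A \<inter> B" by blast
    have eq: "y = x" if "y \<in> \<sigma>" "y \<in> A \<inter> B" for y
      using one[OF admissibleI[OF assms(1) x(2) that(2)]] x that by blast
    have big: "\<not> card (A \<inter> B) \<le> n"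
      using one[OF admissibleI[OF assms(1) x(2) x(2)]] x by blast
    then obtain z where z: "z \<in> A \<inter> B" "z \<noteq> x"
      using assms(3) ex_other_element[of "A \<inter> B" x] by auto
    have "card (\<sigma> - B) = 1"
      using one[OF admissibleI[OF assms(1) x(2) z(1)]] x z by blast
    moreover have "card (\<sigma> - A) = 1"
      using one[OF admissibleI[OF assms(1) z(1) x(2)]] x z by blast
    moreover have "\<sigma> \<inter> (A \<inter> B) = {x}" using x eq by blast
    ultimately show False
      using card_le_parts[OF assms(2), of A B] assms(3,4) by simp
  qed
qed

lemma sum_Qvol_le_nondegenerate:
  fixes X Y :: "'a list \<Rightarrow> rat"
  assumes "n \<ge> 1" and fin: "finite \<Omega>" and X: "X \<in> cycles \<Omega> n" and Y: "Y \<in> cycles \<Omega> n"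
    and card: "card (Vert X \<inter> Vert Y) \<le> n + 1" and M: "M \<in> fillings \<Omega> n (X + Y)"
    and adm: "admissible \<Omega> (Vert X) (Vert Y) n c d"
  shows "fact (n + 2) * (Qvol \<Omega> n X + Qvol \<Omega> n Y) \<le> (\<Sum>vs\<in>tuples \<Omega> (n + 2).
    if inj_on (collapse (Vert X) c) (set vs) \<or> inj_on (collapse (Vert Y) d) (set vs) then \<bar>M vs\<bar> else 0)"
proof -
  let ?f = "collapse (Vert X) c" and ?g = "collapse (Vert Y) d" and ?T = "tuples \<Omega> (n + 2)"
  have Mc: "M \<in> oriented_chains \<Omega> (n + 1)" using M by (simp add: fillings_def)
  have finV: "finite (Vert X \<inter> Vert Y)"
    using Vert_subset[of X \<Omega> n] X fin by (auto simp: cycles_def intro: finite_subset)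
  have f: "push \<Omega> ?f M \<in> fillings \<Omega> n X"
    using adm card by (intro push_collapse_filling[OF fin X Y M]) (auto simp: admissible_def)
  have g: "push \<Omega> ?g M \<in> fillings \<Omega> n Y"
    using adm card M
    by (intro push_collapse_filling[OF fin Y X]) (auto simp: admissible_def add.commute Int_commute)
  have le: "fact (n + 2) * Qvol \<Omega> n Z \<le> (\<Sum>vs\<in>?T. if inj_on h (set vs) then \<bar>M vs\<bar> else 0)"
    if Z: "Z \<in> cycles \<Omega> n" "push \<Omega> h M \<in> fillings \<Omega> n Z" and h: "h ` \<Omega> \<subseteq> \<Omega>" for Z h
  proof -
    have "fact (n + 2) * Qvol \<Omega> n Z \<le> fact (n + 2) * l1_norm (push \<Omega> h M)"
      using Qvol_le[OF fin Z] by (intro mult_left_mono) auto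
    also have "\<dots> = (\<Sum>vs\<in>?T. \<bar>push \<Omega> h M vs\<bar>)"
      using l1_norm_eq_sum_tuples[OF fin, of "push \<Omega> h M" "n + 1"] Z by (simp add: fillings_def)
    also have "\<dots> \<le> (\<Sum>vs\<in>?T. if inj_on h (set vs) then \<bar>M vs\<bar> else 0)"
      using fin Mc h by (rule push_norm_le)
    finally show ?thesis .
  qed
  have "?f ` \<Omega> \<subseteq> \<Omega>" "?g ` \<Omega> \<subseteq> \<Omega>"
    using adm by (auto simp: admissible_def collapse_def)
  then have "fact (n + 2) * (Qvol \<Omega> n X + Qvol \<Omega> n Y)
      \<le> (\<Sum>vs\<in>?T. if inj_on ?f (set vs) then \<bar>M vs\<bar> else 0) + (\<Sum>vs\<in>?T. if inj_on ?g (set vs) then \<bar>M vs\<bar> else 0)"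
    unfolding distrib_left using le X Y f g by (intro add_mono) auto
  also have "\<dots> = (\<Sum>vs\<in>?T. (if inj_on ?f (set vs) then \<bar>M vs\<bar> else 0) + (if inj_on ?g (set vs) then \<bar>M vs\<bar> else 0))"
    by (simp add: sum.distrib)
  also have "\<dots> \<le> (\<Sum>vs\<in>?T. if inj_on ?f (set vs) \<or> inj_on ?g (set vs) then \<bar>M vs\<bar> else 0)"
  proof (rule sum_mono)
    fix vs assume "vs \<in> ?T"
    have "\<not> (inj_on ?f (set vs) \<and> inj_on ?g (set vs))" if "M vs \<noteq> 0"
      using that oriented_chainsD[OF Mc] distinct_card[of vs]
      by (intro collapse_not_both[OF finV assms(1) card _ adm]) (auto simp: tuples_def)
    then show "(if inj_on ?f (set vs) then \<bar>M vs\<bar> else 0) + (if inj_on ?g (set vs) then \<bar>M vs\<bar> else 0)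
        \<le> (if inj_on ?f (set vs) \<or> inj_on ?g (set vs) then \<bar>M vs\<bar> else 0)"
      by auto
  qed
  finally show ?thesis .
qed

lemma Qvol_superadditive:
  assumes "n \<ge> 1" and fin: "finite \<Omega>" and X: "X \<in> cycles \<Omega> n" and Y: "Y \<in> cycles \<Omega> n"
    and card: "card (Vert X \<inter> Vert Y) \<le> n + 1" and M: "M \<in> fillings \<Omega> n (X + Y)"
  shows "Qvol \<Omega> n X + Qvol \<Omega> n Y \<le> l1_norm M"
proof -
  have "Vert X \<subseteq> \<Omega>" using X by (intro Vert_subset) (auto simp: cycles_def)
  then obtain c d where adm: "admissible \<Omega> (Vert X) (Vert Y) n c d"
    using assms(1) by (rule admissible_exists)
  have "fact (n + 2) * (Qvol \<Omega> n X + Qvol \<Omega> n Y) \<le> (\<Sum>vs\<in>tuples \<Omega> (n + 2). \<bar>M vs\<bar>)"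
    by (rule order_trans[OF sum_Qvol_le_nondegenerate[OF assms adm]]) (rule sum_mono, simp)
  also have "\<dots> = fact (n + 2) * l1_norm M"
    using l1_norm_eq_sum_tuples[OF fin, of M "n + 1"] M by (simp add: fillings_def)
  finally show ?thesis by (rule mult_left_le_imp_le) (rule fact_gt_zero)
qed

lemma l1_norm_add_le:
  assumes "finite \<Omega>" "c \<in> oriented_chains \<Omega> k" "d \<in> oriented_chains \<Omega> k"
  shows "l1_norm (c + d) \<le> l1_norm c + l1_norm d"
proof -
  have "fact (k + 1) * l1_norm (c + d) \<le> fact (k + 1) * (l1_norm c + l1_norm d)"
    unfolding distrib_left l1_norm_eq_sum_tuples[OF assms(1) chains_add[OF assms(2,3)]]
      l1_norm_eq_sum_tuples[OF assms(1,2)] l1_norm_eq_sum_tuples[OF assms(1,3)]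
      sum.distrib[symmetric]
    by (rule sum_mono) (simp add: abs_triangle_ineq)
  then show ?thesis by (rule mult_left_le_imp_le) (rule fact_gt_zero)
qed

lemma cycles_add: "X \<in> cycles \<Omega> n \<Longrightarrow> Y \<in> cycles \<Omega> n \<Longrightarrow> X + Y \<in> cycles \<Omega> n"
  by (simp add: cycles_def chains_add boundary_add)

lemma Qvol_add:
  assumes "n \<ge> 1" and fin: "finite \<Omega>" and X: "X \<in> cycles \<Omega> n" and Y: "Y \<in> cycles \<Omega> n"
    and card: "card (Vert X \<inter> Vert Y) \<le> n + 1"
  shows "Qvol \<Omega> n (X + Y) = Qvol \<Omega> n X + Qvol \<Omega> n Y"
proof (rule antisym)
  obtain M N where M: "taut_filling \<Omega> n X M" and N: "taut_filling \<Omega> n Y N"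
    using taut_filling_exists[OF fin X] taut_filling_exists[OF fin Y] by metis
  have "M + N \<in> fillings \<Omega> n (X + Y)"
    using M N by (auto simp: taut_filling_def fillings_def chains_add boundary_add)
  then have "Qvol \<Omega> n (X + Y) \<le> l1_norm (M + N)"
    by (rule Qvol_le[OF fin cycles_add[OF X Y]])
  also have "\<dots> \<le> l1_norm M + l1_norm N"
    using M N by (intro l1_norm_add_le[OF fin]) (auto simp: taut_filling_def fillings_def)
  finally show "Qvol \<Omega> n (X + Y) \<le> Qvol \<Omega> n X + Qvol \<Omega> n Y"
    using M N by (simp add: taut_filling_def)
next
  obtain M where "taut_filling \<Omega> n (X + Y) M"
    using taut_filling_exists[OF fin cycles_add[OF X Y]] by blast
  then show "Qvol \<Omega> n X + Qvol \<Omega> n Y \<le> Qvol \<Omega> n (X + Y)"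
    using Qvol_superadditive[OF assms, of M] by (simp add: taut_filling_def)
qed

lemma taut_nondegenerate:
  assumes "n \<ge> 1" and fin: "finite \<Omega>" and X: "X \<in> cycles \<Omega> n" and Y: "Y \<in> cycles \<Omega> n"
    and card: "card (Vert X \<inter> Vert Y) \<le> n + 1" and M: "taut_filling \<Omega> n (X + Y) M"
    and adm: "admissible \<Omega> (Vert X) (Vert Y) n c d" and vs: "M vs \<noteq> 0"
  shows "inj_on (collapse (Vert X) c) (set vs) \<or> inj_on (collapse (Vert Y) d) (set vs)"
proof (rule ccontr)
  let ?I = "\<lambda>vs. inj_on (collapse (Vert X) c) (set vs) \<or> inj_on (collapse (Vert Y) d) (set vs)"
  let ?T = "tuples \<Omega> (n + 2)"
  assume neg: "\<not> ?I vs"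
  have Mf: "M \<in> fillings \<Omega> n (X + Y)" using M by (simp add: taut_filling_def)
  then have Mc: "M \<in> oriented_chains \<Omega> (n + 1)" by (simp add: fillings_def)
  have "vs \<in> ?T" using oriented_chainsD(2)[OF Mc vs] by simp
  then have "(\<Sum>vs\<in>?T. if ?I vs then \<bar>M vs\<bar> else 0) < (\<Sum>vs\<in>?T. \<bar>M vs\<bar>)"
    using neg vs fin by (intro sum_strict_mono_ex1) auto
  also have "\<dots> = fact (n + 2) * l1_norm M"
    using l1_norm_eq_sum_tuples[OF fin Mc] by simp
  also have "\<dots> = fact (n + 2) * (Qvol \<Omega> n X + Qvol \<Omega> n Y)"
    using M Qvol_add[OF assms(1-5)] by (simp add: taut_filling_def)
  finally show False
    using sum_Qvol_le_nondegenerate[OF assms(1-5) Mf adm] by simp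
qed

text \<open>
  The boundary of the part \<open>M\<^sub>X\<close> of \<open>M\<close> consisting of the simplices near \<open>Vert X\<close> differs from \<open>X\<close> by
  a cycle. A face of simplices of both parts has its vertices in \<open>Vert X \<inter> Vert Y\<close>, so this cycle
  vanishes. A face has at least three vertices because \<open>n \<ge> 2\<close>.
\<close>

lemma taut_filling_splits:
  assumes "n \<ge> 2" and fin: "finite \<Omega>" and X: "X \<in> cycles \<Omega> n" and Y: "Y \<in> cycles \<Omega> n"
    and card: "card (Vert X \<inter> Vert Y) \<le> n + 1" and M: "taut_filling \<Omega> n (X + Y) M"
  obtains M\<^sub>X M\<^sub>Y where "taut_filling \<Omega> n X M\<^sub>X" "taut_filling \<Omega> n Y M\<^sub>Y" "M = M\<^sub>X + M\<^sub>Y"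
proof -
  have n1: "n \<ge> 1" using assms(1) by simp
  let ?A = "Vert X" and ?B = "Vert Y" and ?T = "tuples \<Omega> (n + 2)"
  have XY: "X \<in> oriented_chains \<Omega> n" "boundary \<Omega> X = 0" "Y \<in> oriented_chains \<Omega> n" "boundary \<Omega> Y = 0"
    using X Y by (auto simp: cycles_def)
  have Mc: "M \<in> oriented_chains \<Omega> (n + 1)" and dM: "boundary \<Omega> M = X + Y"
    and norm: "l1_norm M = Qvol \<Omega> n X + Qvol \<Omega> n Y"
    using M Qvol_add[OF n1 fin X Y card] by (auto simp: taut_filling_def fillings_def)
  define near where "near A \<sigma> \<longleftrightarrow> \<sigma> \<subseteq> A \<or> \<sigma> \<inter> (?A \<inter> ?B) = {} \<and> card (\<sigma> - A) = 1" for A \<sigma>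
  have near: "near ?A (set vs) \<or> near ?B (set vs)" if "M vs \<noteq> 0" for vs
  proof -
    have "card (set vs) = n + 2"
      using oriented_chainsD(2,3)[OF Mc that] distinct_card[of vs] by (auto simp: tuples_def)
    then show ?thesis
      using collapse_always_one[OF Vert_subset[OF XY(1)] _ assms(1), of "set vs" ?B]
        taut_nondegenerate[OF n1 fin X Y card M _ that] unfolding near_def by blast
  qed
  define M\<^sub>X where "M\<^sub>X = (\<lambda>vs. if near ?A (set vs) then M vs else 0)"
  define M\<^sub>Y where "M\<^sub>Y = M - M\<^sub>X"
  have MXc: "M\<^sub>X \<in> oriented_chains \<Omega> (n + 1)"
  proof (rule oriented_chainsI)
    show "alternating M\<^sub>X"
      using oriented_chainsD(1)[OF Mc] by (auto simp: alternating_def M\<^sub>X_def)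
    show "vs \<in> tuples \<Omega> (n + 1 + 1)" if "M\<^sub>X vs \<noteq> 0" for vs
      using that oriented_chainsD(2)[OF Mc, of vs] by (auto simp: M\<^sub>X_def split: if_splits)
  qed
  have MYc: "M\<^sub>Y \<in> oriented_chains \<Omega> (n + 1)"
    unfolding M\<^sub>Y_def using Mc MXc by (rule chains_diff)
  have M_eq: "M = M\<^sub>X + M\<^sub>Y" by (simp add: M\<^sub>Y_def)
  have near_X: "near ?A (set vs)" if "M\<^sub>X vs \<noteq> 0" for vs
    using that by (auto simp: M\<^sub>X_def split: if_splits)
  have near_Y: "near ?B (set vs)" if "M\<^sub>Y vs \<noteq> 0" for vs
    using that near[of vs] by (auto simp: M\<^sub>Y_def M\<^sub>X_def split: if_splits)
  have face: "set ws \<subseteq> A \<or> set ws \<inter> (?A \<inter> ?B) = {} \<and> card (set ws - A) \<le> 1"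
    if N: "\<And>vs. N vs \<noteq> 0 \<Longrightarrow> near A (set vs)" "boundary \<Omega> N ws \<noteq> 0" for N A and ws :: "'a list"
  proof -
    obtain x where "N (x # ws) \<noteq> 0"
      using N(2) unfolding boundary_def by (meson sum.not_neutral_contains_not_neutral)
    then have x: "near A (set (x # ws))" by (rule N(1))
    have "card (set ws - A) \<le> card (set (x # ws) - A)" by (intro card_mono) auto
    then show ?thesis using x by (auto simp: near_def)
  qed
  have dMX: "boundary \<Omega> M\<^sub>X = X"
  proof -
    let ?W = "boundary \<Omega> M\<^sub>X - X"
    have W: "?W = Y - boundary \<Omega> M\<^sub>Y"
      using dM by (simp add: M\<^sub>Y_def boundary_diff)
    have bc: "boundary \<Omega> M\<^sub>X \<in> oriented_chains \<Omega> n"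
    proof (rule oriented_chainsI)
      show "alternating (boundary \<Omega> M\<^sub>X)" using MXc by (intro alternating_boundary oriented_chainsD(1))
      fix ws assume "boundary \<Omega> M\<^sub>X ws \<noteq> 0"
      then obtain x where "M\<^sub>X (x # ws) \<noteq> 0"
        unfolding boundary_def by (meson sum.not_neutral_contains_not_neutral)
      then show "ws \<in> tuples \<Omega> (n + 1)"
        using oriented_chainsD(2)[OF MXc, of "x # ws"] by (simp add: tuples_def)
    qed
    have Wc: "?W \<in> oriented_chains \<Omega> n" using bc XY(1) by (rule chains_diff)
    have "set ws \<subseteq> ?A \<inter> ?B" if ws: "?W ws \<noteq> 0" for ws
    proof -
      have len: "card (set ws) = n + 1"
        using oriented_chainsD(2,3)[OF Wc ws] distinct_card[of ws] by (auto simp: tuples_def)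
      have "boundary \<Omega> M\<^sub>X ws \<noteq> 0 \<or> X ws \<noteq> 0" using ws by auto
      then have 1: "set ws \<subseteq> ?A \<or> set ws \<inter> (?A \<inter> ?B) = {} \<and> card (set ws - ?A) \<le> 1"
        using face[OF near_X] set_subset_Vert[of X ws] by blast
      have "boundary \<Omega> M\<^sub>Y ws \<noteq> 0 \<or> Y ws \<noteq> 0" using ws unfolding W by auto
      then have 2: "set ws \<subseteq> ?B \<or> set ws \<inter> (?A \<inter> ?B) = {} \<and> card (set ws - ?B) \<le> 1"
        using face[OF near_Y] set_subset_Vert[of Y ws] by blast
      have "\<not> (set ws \<inter> (?A \<inter> ?B) = {} \<and> card (set ws - ?A) \<le> 1 \<and> card (set ws - ?B) \<le> 1)"
        using card_le_parts[of "set ws" ?A ?B] len assms(1) by auto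
      moreover have "card (set ws - A) \<le> 1" if "set ws \<subseteq> A" for A
        using that by (simp add: Diff_eq_empty_iff[THEN iffD2])
      ultimately show ?thesis using 1 2 by blast
    qed
    then have "Vert ?W \<subseteq> ?A \<inter> ?B" by (auto simp: Vert_def)
    moreover have "boundary \<Omega> ?W = 0"
      using XY(2) boundary_boundary[OF oriented_chainsD(1)[OF MXc]] by (simp add: boundary_diff)
    moreover have "finite (?A \<inter> ?B)"
      using Vert_subset[OF XY(1)] fin by (auto intro: finite_subset)
    ultimately have "?W = 0"
      using card by (intro cycle_on_few_vertices[OF fin Wc]) auto
    then show ?thesis by simp
  qed
  then have dMY: "boundary \<Omega> M\<^sub>Y = Y" using dM by (simp add: M\<^sub>Y_def boundary_diff)
  have fill: "M\<^sub>X \<in> fillings \<Omega> n X" "M\<^sub>Y \<in> fillings \<Omega> n Y"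
    using MXc MYc dMX dMY by (auto simp: fillings_def)
  have "fact (n + 1 + 1) * (l1_norm M\<^sub>X + l1_norm M\<^sub>Y) = fact (n + 1 + 1) * l1_norm M"
    unfolding distrib_left l1_norm_eq_sum_tuples[OF fin MXc] l1_norm_eq_sum_tuples[OF fin MYc]
      l1_norm_eq_sum_tuples[OF fin Mc] sum.distrib[symmetric]
    by (intro sum.cong) (auto simp: M\<^sub>X_def M\<^sub>Y_def)
  then have "l1_norm M\<^sub>X + l1_norm M\<^sub>Y = Qvol \<Omega> n X + Qvol \<Omega> n Y"
    using norm by (simp only: mult_cancel_left fact_nonzero if_False) simp
  then have "taut_filling \<Omega> n X M\<^sub>X" "taut_filling \<Omega> n Y M\<^sub>Y"
    using fill Qvol_le[OF fin X fill(1)] Qvol_le[OF fin Y fill(2)] by (auto simp: taut_filling_def)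
  then show ?thesis using M_eq by (rule that)
qed

theorem corollary2:
  fixes \<Omega> :: "'a set" and n :: nat and X Y :: "'a list \<Rightarrow> rat"
  assumes "n \<ge> 1"
    and "finite \<Omega>"
    and "X \<in> cycles \<Omega> n" and "Y \<in> cycles \<Omega> n"
    and "card (Vert X \<inter> Vert Y) \<le> n + 1"
  shows "Qvol \<Omega> n (X + Y) = Qvol \<Omega> n X + Qvol \<Omega> n Y \<and>
    (n \<ge> 2 \<longrightarrow>
      (\<forall>M. taut_filling \<Omega> n (X + Y) M \<longrightarrow>
        (\<exists>M_X M_Y. taut_filling \<Omega> n X M_X \<and> taut_filling \<Omega> n Y M_Y \<and> M = M_X + M_Y)))"
proof (intro conjI impI allI)
  show "Qvol \<Omega> n (X + Y) = Qvol \<Omega> n X + Qvol \<Omega> n Y"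
    using assms by (rule Qvol_add)
  fix M assume "n \<ge> 2" "taut_filling \<Omega> n (X + Y) M"
  then show "\<exists>M_X M_Y. taut_filling \<Omega> n X M_X \<and> taut_filling \<Omega> n Y M_Y \<and> M = M_X + M_Y"
    using taut_filling_splits[OF _ assms(2-5)] by metis
qed

end
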